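(* Let $n\ge 1$ and let $\phi\in \mathrm{Aut}(\mathbb{Z}^n)=GL_n(\mathbb{Z})$ be an automorphism which is diagonalizable over $\mathbb{R}$ (so that all of its eigenvalues are real). Then every subgroup of $P_{n,\phi}=\mathbb{Z}^n\rtimes_{\phi}\mathbb{Z}$ has bounded packing in $P_{n,\phi}$.
   Context: The semidirect product is $\mathbb{Z}^n\rtimes_{\phi}\mathbb{Z}=\langle \mathbb{Z}^n,t : tat^{-1}=\phi(a),\ a\in\mathbb{Z}^n\rangle$, where $t$ denotes a generator of the $\mathbb{Z}$ factor on the right. Bounded packing: let $G$ be a finitely generated group with word metric $d$ with respect to a finite generating set (the property below does not depend on this choice), and for subsets $X,Y\subseteq G$ put $d(X,Y)=\inf\{d(x,y):x\in X,\ y\in Y\}$. A subgroup $H\le G$ has bounded packing in $G$ if for every $r>0$ there is a number $N$ (which may depend on $G$, $H$ and $r$) such that any collection of $N$ distinct left cosets $\{g_1H,\dots,g_NH\}$ of $H$ in $G$ contains a pair of distinct cosets $g_iH,g_jH$ with $d(g_iH,g_jH)\ge r$. *)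

theory Defs
  imports
    "HOL-Algebra.Bij"
    "HOL-Algebra.Elementary_Groups"
    "HOL-Algebra.Left_Coset"
    "Jordan_Normal_Form.Matrix"
begin

section \<open>Semidirect products\<close>

definition semidirect ::
  "('a, 'c) monoid_scheme \<Rightarrow> ('b, 'd) monoid_scheme \<Rightarrow> ('b \<Rightarrow> 'a \<Rightarrow> 'a) \<Rightarrow> ('a \<times> 'b) monoid"
where
  "semidirect A B \<theta> =
    \<lparr>carrier = carrier A \<times> carrier B,
     monoid.mult = (\<lambda>(a, s) (b, u). (a \<otimes>\<^bsub>A\<^esub> \<theta> s b, s \<otimes>\<^bsub>B\<^esub> u)),
     one = (\<one>\<^bsub>A\<^esub>, \<one>\<^bsub>B\<^esub>)\<rparr>"

lemma group_semidirect:
  assumes "group A" "group B" "\<theta> \<in> hom B (AutoGroup A)"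
  shows "group (semidirect A B \<theta>)"
proof -
  interpret A: group A by fact
  interpret B: group B by fact
  interpret Au: group "AutoGroup A" by (rule A.AutoGroup)
  interpret \<theta>: group_hom B "AutoGroup A" \<theta>
    by (unfold_locales) (rule assms(3))
  have auto: "\<theta> s \<in> auto A" if "s \<in> carrier B" for s
    using \<theta>.hom_closed[OF that] by (simp add: AutoGroup_def)
  have cl: "\<theta> s a \<in> carrier A" if "s \<in> carrier B" "a \<in> carrier A" for s a
    using auto[OF that(1)] that(2) by (auto simp: auto_def hom_def)
  have mul: "\<theta> s (a \<otimes>\<^bsub>A\<^esub> b) = \<theta> s a \<otimes>\<^bsub>A\<^esub> \<theta> s b"
    if "s \<in> carrier B" "a \<in> carrier A" "b \<in> carrier A" for s a b
    using auto[OF that(1)] that by (auto simp: auto_def hom_def)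
  have comp: "\<theta> (s \<otimes>\<^bsub>B\<^esub> u) a = \<theta> s (\<theta> u a)"
    if "s \<in> carrier B" "u \<in> carrier B" "a \<in> carrier A" for s u a
    using \<theta>.hom_mult[OF that(1,2)] auto[OF that(1)] auto[OF that(2)] that(3)
    by (auto simp: AutoGroup_def BijGroup_def auto_def compose_def)
  have id: "\<theta> \<one>\<^bsub>B\<^esub> a = a" if "a \<in> carrier A" for a
    using \<theta>.hom_one that by (simp add: AutoGroup_def BijGroup_def)
  show ?thesis
  proof (rule groupI)
    fix x assume "x \<in> carrier (semidirect A B \<theta>)"
    then obtain a s where x: "x = (a, s)" "a \<in> carrier A" "s \<in> carrier B"
      by (auto simp: semidirect_def)
    let ?y = "(\<theta> (inv\<^bsub>B\<^esub> s) (inv\<^bsub>A\<^esub> a), inv\<^bsub>B\<^esub> s)"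
    have "?y \<in> carrier (semidirect A B \<theta>)"
      using x cl[of "inv\<^bsub>B\<^esub> s" "inv\<^bsub>A\<^esub> a"]
      by (simp add: semidirect_def del: \<theta>.hom_inv)
    moreover have "?y \<otimes>\<^bsub>semidirect A B \<theta>\<^esub> x = \<one>\<^bsub>semidirect A B \<theta>\<^esub>"
    proof -
      have "\<theta> (inv\<^bsub>B\<^esub> s) \<one>\<^bsub>A\<^esub> = \<one>\<^bsub>A\<^esub>"
        using mul[of "inv\<^bsub>B\<^esub> s" "\<one>\<^bsub>A\<^esub>" "\<one>\<^bsub>A\<^esub>"] cl[of "inv\<^bsub>B\<^esub> s" "\<one>\<^bsub>A\<^esub>"] x
        by (simp del: \<theta>.hom_inv)
      then show ?thesis
        using x by (simp add: semidirect_def mul[symmetric] del: \<theta>.hom_inv)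
    qed
    ultimately show "\<exists>y\<in>carrier (semidirect A B \<theta>). y \<otimes>\<^bsub>semidirect A B \<theta>\<^esub> x = \<one>\<^bsub>semidirect A B \<theta>\<^esub>"
      by blast
  qed (auto simp: semidirect_def cl mul comp id A.m_assoc B.m_assoc
      simp del: \<theta>.hom_mult \<theta>.hom_one)
qed

abbreviation Zn :: "nat \<Rightarrow> int vec monoid"
  where "Zn n \<equiv> monoid_vec TYPE(int) n"

text \<open>The integer \<open>k\<close> acts on \<open>Zn n\<close> as the \<open>k\<close>-th power of \<open>\<phi>\<close> in the automorphism group.\<close>

definition Zn_semidirect_Z :: "nat \<Rightarrow> (int vec \<Rightarrow> int vec) \<Rightarrow> (int vec \<times> int) monoid"
  where "Zn_semidirect_Z n \<phi> =
    semidirect (Zn n) integer_group (\<lambda>k. \<phi> [^]\<^bsub>AutoGroup (Zn n)\<^esub> (k::int))"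

lemma group_Zn: "group (Zn n)"
  using comm_group_vec comm_group.axioms(2) by blast

lemma group_Zn_semidirect_Z:
  assumes "\<phi> \<in> auto (Zn n)"
  shows "group (Zn_semidirect_Z n \<phi>)"
proof -
  interpret Au: group "AutoGroup (Zn n)"
    by (rule group.AutoGroup[OF group_Zn])
  have "\<phi> \<in> carrier (AutoGroup (Zn n))"
    using assms by (simp add: AutoGroup_def)
  then have "(\<lambda>k. \<phi> [^]\<^bsub>AutoGroup (Zn n)\<^esub> (k::int)) \<in> hom integer_group (AutoGroup (Zn n))"
    by (intro homI) (auto simp: Au.int_pow_mult)
  then show ?thesis
    unfolding Zn_semidirect_Z_def
    by (intro group_semidirect group_Zn group_integer_group)
qed

text \<open>With \<open>t = (0, 1)\<close> this is the defining relation \<open>t a t\<inverse> = \<phi> a\<close>.\<close>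

lemma Zn_semidirect_Z_conj:
  assumes "\<phi> \<in> auto (Zn n)" "a \<in> carrier_vec n"
  defines "G \<equiv> Zn_semidirect_Z n \<phi>"
  shows "(0\<^sub>v n, 1) \<otimes>\<^bsub>G\<^esub> (a, 0) \<otimes>\<^bsub>G\<^esub> inv\<^bsub>G\<^esub> (0\<^sub>v n, 1) = (\<phi> a, 0)"
proof -
  interpret G: group G unfolding G_def by (rule group_Zn_semidirect_Z[OF assms(1)])
  interpret Au: group "AutoGroup (Zn n)"
    by (rule group.AutoGroup[OF group_Zn])
  have \<phi>: "\<phi> \<in> carrier (AutoGroup (Zn n))"
    using assms by (simp add: AutoGroup_def)
  have \<phi>a: "\<phi> a \<in> carrier_vec n"
    using assms by (auto simp: auto_def hom_def monoid_vec_def)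
  have c: "(v, k) \<in> carrier G \<longleftrightarrow> v \<in> carrier_vec n" for v k
    by (simp add: G_def Zn_semidirect_Z_def semidirect_def monoid_vec_def)
  have one: "\<phi> [^]\<^bsub>AutoGroup (Zn n)\<^esub> (0::int) = (\<lambda>x\<in>carrier_vec n. x)"
    by (simp add: AutoGroup_def BijGroup_def monoid_vec_def)
  have "(0\<^sub>v n, 1) \<otimes>\<^bsub>G\<^esub> (a, 0) = (\<phi> a, 0) \<otimes>\<^bsub>G\<^esub> (0\<^sub>v n, 1)"
    using \<phi> \<phi>a Au.int_pow_1[OF \<phi>] one
    by (simp add: G_def Zn_semidirect_Z_def semidirect_def monoid_vec_def)
  then show ?thesis
    using \<phi>a assms(2) by (simp add: c G.inv_solve_right')
qed

section \<open>Diagonalizability over the reals\<close>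

definition end_matrix :: "nat \<Rightarrow> (int vec \<Rightarrow> int vec) \<Rightarrow> int mat"
  where "end_matrix n \<phi> = mat n n (\<lambda>(i, j). \<phi> (unit_vec n j) $ i)"

lemma auto_eq_mult_end_matrix:
  assumes "\<phi> \<in> auto (Zn n)" "v \<in> carrier_vec n"
  shows "\<phi> v = end_matrix n \<phi> *\<^sub>v v"
proof -
  let ?M = "end_matrix n \<phi>"
  have M: "?M \<in> carrier_mat n n" by (simp add: end_matrix_def)
  have cl: "\<phi> u \<in> carrier_vec n" if "u \<in> carrier_vec n" for u
    using assms(1) that by (auto simp: auto_def hom_def monoid_vec_def)
  have add: "\<phi> (u + w) = \<phi> u + \<phi> w" if "u \<in> carrier_vec n" "w \<in> carrier_vec n" for u w
    using assms(1) that by (auto simp: auto_def hom_def monoid_vec_def)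
  have zero: "\<phi> (0\<^sub>v n) = 0\<^sub>v n"
  proof -
    have "\<phi> (0\<^sub>v n) = \<phi> (0\<^sub>v n) + \<phi> (0\<^sub>v n)"
      using add[of "0\<^sub>v n" "0\<^sub>v n"] by simp
    then have "\<phi> (0\<^sub>v n) $ i = 0" if "i < n" for i
      using cl[of "0\<^sub>v n"] that by (metis add_cancel_right_left carrier_vecD index_add_vec(1) zero_carrier_vec)
    then show ?thesis using cl[of "0\<^sub>v n"] by (intro eq_vecI) auto
  qed
  have nat: "\<phi> (int k \<cdot>\<^sub>v u) = int k \<cdot>\<^sub>v \<phi> u" if u: "u \<in> carrier_vec n" for k u
  proof (induction k)
    case 0
    have "0 \<cdot>\<^sub>v u = 0\<^sub>v n" "0 \<cdot>\<^sub>v \<phi> u = 0\<^sub>v n"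
      using u cl[OF u] by auto
    then show ?case by (simp add: zero)
  next
    case (Suc k)
    have *: "int (Suc k) \<cdot>\<^sub>v w = w + int k \<cdot>\<^sub>v w" if "w \<in> carrier_vec n" for w :: "int vec"
      using that by (intro eq_vecI) (auto simp: algebra_simps)
    show ?case using *[OF u] *[OF cl[OF u]] Suc u by (simp add: add)
  qed
  have smult: "\<phi> (k \<cdot>\<^sub>v u) = k \<cdot>\<^sub>v \<phi> u" if u: "u \<in> carrier_vec n" for k u
  proof (cases "k \<ge> 0")
    case True
    then show ?thesis using nat[OF u, of "nat k"] by simp
  next
    case False
    define m where "m = nat (- k)"
    have k: "k = - int m" using False by (simp add: m_def)
    have "k \<cdot>\<^sub>v u + int m \<cdot>\<^sub>v u = 0\<^sub>v n"
      using u by (intro eq_vecI) (auto simp: k)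
    then have "\<phi> (k \<cdot>\<^sub>v u) + int m \<cdot>\<^sub>v \<phi> u = 0\<^sub>v n"
      using add[of "k \<cdot>\<^sub>v u" "int m \<cdot>\<^sub>v u"] u nat[OF u] zero by simp
    then have eq: "(\<phi> (k \<cdot>\<^sub>v u) + int m \<cdot>\<^sub>v \<phi> u) $ i = 0" if "i < n" for i
      using that by simp
    show ?thesis
    proof (rule eq_vecI)
      fix i assume "i < dim_vec (k \<cdot>\<^sub>v \<phi> u)"
      then have i: "i < n" using cl[OF u] by simp
      show "\<phi> (k \<cdot>\<^sub>v u) $ i = (k \<cdot>\<^sub>v \<phi> u) $ i"
        using eq[OF i] i cl[OF u] by (simp add: k)
    qed (use cl[OF u] cl[of "k \<cdot>\<^sub>v u"] u in auto)
  qed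
  have M_smult: "?M *\<^sub>v (k \<cdot>\<^sub>v u) = k \<cdot>\<^sub>v (?M *\<^sub>v u)" if "u \<in> carrier_vec n" for k u
    using that M by (intro eq_vecI) auto
  define w where "w m = vec n (\<lambda>i. if i < m then v $ i else 0)" for m
  have unit: "\<phi> (unit_vec n j) = ?M *\<^sub>v unit_vec n j" if "j < n" for j
    using that cl[of "unit_vec n j"]
    by (intro eq_vecI) (auto simp: end_matrix_def)
  have "\<phi> (w m) = ?M *\<^sub>v w m" if "m \<le> n" for m
    using that
  proof (induction m)
    case 0
    have "w 0 = 0\<^sub>v n" by (intro eq_vecI) (auto simp: w_def)
    then show ?case using M by (auto simp: zero intro!: eq_vecI)
  next
    case (Suc m)
    have wm: "w m \<in> carrier_vec n" by (simp add: w_def)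
    have "w (Suc m) = w m + v $ m \<cdot>\<^sub>v unit_vec n m"
      using Suc.prems by (intro eq_vecI) (auto simp: w_def unit_vec_def less_Suc_eq)
    then show ?case
      using Suc wm M by (simp add: add smult unit mult_add_distrib_mat_vec[OF M] M_smult)
  qed
  moreover have "w n = v"
    using assms(2) by (intro eq_vecI) (auto simp: w_def)
  ultimately show ?thesis by force
qed

definition diagonalizable :: "'a :: semiring_1 mat \<Rightarrow> bool"
  where "diagonalizable A \<longleftrightarrow> (\<exists>D. diagonal_mat D \<and> similar_mat A D)"

definition diagonalizable_over_reals :: "nat \<Rightarrow> (int vec \<Rightarrow> int vec) \<Rightarrow> bool"
  where "diagonalizable_over_reals n \<phi> \<longleftrightarrow>
    diagonalizable (map_mat real_of_int (end_matrix n \<phi>))"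

section \<open>Word metrics and bounded packing\<close>

definition finite_generating_set :: "('a, 'b) monoid_scheme \<Rightarrow> 'a set \<Rightarrow> bool"
  where "finite_generating_set G S \<longleftrightarrow>
    finite S \<and> S \<subseteq> carrier G \<and> generate G S = carrier G"

definition word_length :: "('a, 'b) monoid_scheme \<Rightarrow> 'a set \<Rightarrow> 'a \<Rightarrow> nat"
  where "word_length G S g =
    (LEAST k. \<exists>ws. set ws \<subseteq> S \<union> m_inv G ` S \<and> length ws = k \<and> foldr (monoid.mult G) ws \<one>\<^bsub>G\<^esub> = g)"

definition word_dist :: "('a, 'b) monoid_scheme \<Rightarrow> 'a set \<Rightarrow> 'a \<Rightarrow> 'a \<Rightarrow> nat"
  where "word_dist G S x y = word_length G S (inv\<^bsub>G\<^esub> x \<otimes>\<^bsub>G\<^esub> y)"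

definition word_setdist :: "('a, 'b) monoid_scheme \<Rightarrow> 'a set \<Rightarrow> 'a set \<Rightarrow> 'a set \<Rightarrow> nat"
  where "word_setdist G S X Y = (INF (x, y) \<in> X \<times> Y. word_dist G S x y)"

text \<open>
  The index \<open>N\<close> below is necessarily positive: for \<open>N = 0\<close> the empty collection violates the condition.
  Hence \<open>card C = N\<close> only concerns finite collections.
\<close>

definition bounded_packing_wrt :: "('a, 'b) monoid_scheme \<Rightarrow> 'a set \<Rightarrow> 'a set \<Rightarrow> bool"
  where "bounded_packing_wrt G S H \<longleftrightarrow>
    (\<forall>r::real. r > 0 \<longrightarrow>
      (\<exists>N::nat. \<forall>C. C \<subseteq> lcosets\<^bsub>G\<^esub> H \<and> card C = N \<longrightarrow>
        (\<exists>X\<in>C. \<exists>Y\<in>C. X \<noteq> Y \<and> real (word_setdist G S X Y) \<ge> r)))"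

text \<open>
  Bounded packing does not depend on the finite generating set. It is required here for all of
  them, together with the existence of at least one, so that it is not vacuously true for groups
  that are not finitely generated.
\<close>

definition bounded_packing :: "('a, 'b) monoid_scheme \<Rightarrow> 'a set \<Rightarrow> bool"
  where "bounded_packing G H \<longleftrightarrow>
    (\<exists>S. finite_generating_set G S) \<and>
    (\<forall>S. finite_generating_set G S \<longrightarrow> bounded_packing_wrt G S H)"

end

theory Submission
  imports Defs "HOL-Library.Function_Algebras"
begin

text \<open>
  Word balls are finite, so bounded packing of \<open>H\<close> says that for each finite \<open>B\<close> there is a bound on the
  number of distinct cosets of \<open>H\<close> any two of which contain points with quotient in \<open>B\<close>
  (\<open>bounded_packing_wrtI\<close>).

  Let \<open>K = H \<inter> \<int>\<^sup>n\<close> and let \<open>m\<close> generate the image of \<open>H\<close> in \<open>\<int>\<close>. After a pigeonhole step on the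
  \<open>\<int>\<close>-part, close cosets are represented by vectors \<open>a \<in> \<int>\<^sup>n\<close> with pairwise differences in
  \<open>H B H \<inter> \<int>\<^sup>n\<close>. Modulo \<open>K\<close> these differences have the form \<open>\<psi>\<^sup>s f\<close>, where \<open>\<psi> = \<phi>\<^sup>m\<close>, \<open>s \<in> \<int>\<close>, and
  \<open>f\<close> ranges over a finite set \<open>F\<close> (\<open>double_coset_vec\<close>). The claim becomes a statement about the
  automorphism induced by \<open>\<psi>\<close> on the abelian group \<open>\<int>\<^sup>n / K\<close>: a set all of whose differences lie in
  the orbits of \<open>F\<close> has bounded size (\<open>clique_bound\<close>).

  Diagonalizability provides, for each eigenvalue \<open>\<nu>\<close>, a seminorm on \<open>\<int>\<^sup>n / K\<close> that \<open>\<psi>\<close> scales by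
  exactly \<open>\<bar>\<nu>\<bar>\<close>, namely the distance to the real span of \<open>K\<close> within the \<open>\<nu>\<close>-eigenspace; only finitely
  many classes are bounded in all of them (\<open>eigendist_bounded_finite_mod_K\<close>). An \<open>f\<close> on which all expanding
  seminorms vanish has a bounded forward orbit, which is finite, so its full orbit is finite
  (\<open>bounded_orbit_finite_mod_K\<close>) and contributes finitely many differences. Among the remaining
  differences consider one, \<open>a - b = \<psi>\<^sup>S f\<close>, with the largest exponent. In an expanding direction every
  third point is far from \<open>a\<close> or from \<open>b\<close>, which forces its exponent to be within a constant of \<open>S\<close>.
  So relative to \<open>a\<close> or \<open>b\<close> it has boundedly many positions.
\<close>

section \<open>Spans and subgroups of sequences\<close>

abbreviation fscale :: "real \<Rightarrow> (nat \<Rightarrow> real) \<Rightarrow> nat \<Rightarrow> real"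
  where "fscale c x \<equiv> (\<lambda>i. c * x i)"

interpretation seq: vector_space fscale
  by unfold_locales (auto simp: algebra_simps fun_eq_iff)

lemma sum_fun_apply: "sum f A i = (\<Sum>a\<in>A. f a i)" for f :: "'b \<Rightarrow> 'c \<Rightarrow> 'd::comm_monoid_add"
  by (induction A rule: infinite_finite_induct) auto

definition additive_subgroup :: "'a::ab_group_add set \<Rightarrow> bool"
  where "additive_subgroup K \<longleftrightarrow> 0 \<in> K \<and> (\<forall>x\<in>K. \<forall>y\<in>K. x - y \<in> K)"

lemma additive_subgroup_zero: "additive_subgroup K \<Longrightarrow> 0 \<in> K"
  and additive_subgroup_diff: "additive_subgroup K \<Longrightarrow> x \<in> K \<Longrightarrow> y \<in> K \<Longrightarrow> x - y \<in> K"
  by (auto simp: additive_subgroup_def)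

lemma additive_subgroup_uminus: "additive_subgroup K \<Longrightarrow> x \<in> K \<Longrightarrow> - x \<in> K"
  using additive_subgroup_diff[of K 0 x] additive_subgroup_zero[of K] by simp

lemma additive_subgroup_add: "additive_subgroup K \<Longrightarrow> x \<in> K \<Longrightarrow> y \<in> K \<Longrightarrow> x + y \<in> K"
  using additive_subgroup_diff[of K x "- y"] additive_subgroup_uminus[of K y] by simp

lemma additive_subgroup_sum:
  assumes "additive_subgroup K" "\<And>b. b \<in> B \<Longrightarrow> f b \<in> K"
  shows "sum f B \<in> K"
  using assms(2)
  by (induction B rule: infinite_finite_induct)
    (auto intro: additive_subgroup_zero[OF assms(1)] additive_subgroup_add[OF assms(1)])

text \<open>
  Rounding real coefficients down to integers is how a vector in the real span of \<open>K\<close> gets replaced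
  by a nearby element of \<open>K\<close> itself; this closure property keeps the rounded vector in \<open>K\<close>.
\<close>

lemma additive_subgroup_int_scale:
  assumes K: "additive_subgroup K" and x: "x \<in> K"
  shows "fscale (of_int k) x \<in> K"
proof -
  have nat: "fscale (of_nat m) x \<in> K" for m
  proof (induction m)
    case 0
    then show ?case using additive_subgroup_zero[OF K] by (simp add: zero_fun_def)
  next
    case (Suc m)
    have "fscale (of_nat (Suc m)) x = fscale (of_nat m) x + x"
      by (auto simp: algebra_simps)
    then show ?case using additive_subgroup_add[OF K Suc x] by simp
  qed
  show ?thesis
  proof (cases k)
    case (nonneg m)
    then show ?thesis using nat by simp
  next
    case (neg m)
    have "fscale (of_int k) x = - fscale (of_nat (Suc m)) x"
      by (simp add: neg fun_eq_iff algebra_simps)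
    then show ?thesis using additive_subgroup_uminus[OF K nat] by metis
  qed
qed

section \<open>Lattices with a diagonal action\<close>

text \<open>
  The setting of the dynamical argument. \<open>\<Lambda>\<close> is a lattice of vectors in \<open>\<real>\<^sup>n\<close>, written as real
  sequences that vanish from index \<open>n\<close> on, so that \<open>n\<close> can stay a term. In these coordinates the
  automorphism is diagonal with eigenvalues \<open>\<mu> i\<close>, and \<open>K\<close> is an invariant subgroup of \<open>\<Lambda>\<close>.
  Eigenvalues are indexed by all natural numbers and are nonzero everywhere, which makes the integer
  powers \<open>T s\<close> of the diagonal operator a group of bijections of the whole type.
\<close>

locale diagonal_lattice =
  fixes n :: nat and \<mu> :: "nat \<Rightarrow> real" and \<Lambda> K :: "(nat \<Rightarrow> real) set"
  assumes eigenvalue_nonzero: "\<mu> i \<noteq> 0"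
    and \<Lambda>: "additive_subgroup \<Lambda>"
    and \<Lambda>_support: "x \<in> \<Lambda> \<Longrightarrow> n \<le> i \<Longrightarrow> x i = 0"
    and \<Lambda>_discrete: "finite {x \<in> \<Lambda>. \<forall>i<n. \<bar>x i\<bar> \<le> R}"
    and K: "additive_subgroup K"
    and K_subset: "K \<subseteq> \<Lambda>"
    and \<Lambda>_invariant: "x \<in> \<Lambda> \<Longrightarrow> (\<lambda>i. \<mu> i powi s * x i) \<in> \<Lambda>"
    and K_invariant: "x \<in> K \<Longrightarrow> (\<lambda>i. \<mu> i powi s * x i) \<in> K"
begin

definition T :: "int \<Rightarrow> (nat \<Rightarrow> real) \<Rightarrow> nat \<Rightarrow> real"
  where "T s x = (\<lambda>i. \<mu> i powi s * x i)"

lemma T_add: "T (s + u) x = T s (T u x)"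
  by (auto simp: T_def power_int_add eigenvalue_nonzero)

lemma T_0: "T 0 x = x"
  by (simp add: T_def)

lemma T_minus: "T s (x - y) = T s x - T s y"
  by (auto simp: T_def algebra_simps)

lemma T_\<Lambda>: "x \<in> \<Lambda> \<Longrightarrow> T s x \<in> \<Lambda>"
  and T_K: "x \<in> K \<Longrightarrow> T s x \<in> K"
  using \<Lambda>_invariant K_invariant by (auto simp: T_def)

definition W :: "(nat \<Rightarrow> real) set"
  where "W = seq.span K"

lemma W_add: "x \<in> W \<Longrightarrow> y \<in> W \<Longrightarrow> x + y \<in> W"
  and W_diff: "x \<in> W \<Longrightarrow> y \<in> W \<Longrightarrow> x - y \<in> W"
  and W_scale: "x \<in> W \<Longrightarrow> fscale c x \<in> W"
  and W_zero: "0 \<in> W"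
  and K_W: "x \<in> K \<Longrightarrow> x \<in> W"
  unfolding W_def
  by (auto intro: seq.span_add seq.span_diff seq.span_scale seq.span_zero seq.span_base)

lemma W_sum: "(\<And>b. b \<in> B \<Longrightarrow> f b \<in> W) \<Longrightarrow> sum f B \<in> W"
  unfolding W_def by (rule seq.span_sum)

lemma W_T: "x \<in> W \<Longrightarrow> (\<lambda>i. \<mu> i * x i) \<in> W"
  unfolding W_def
proof (induction rule: seq.span_induct_alt)
  case base
  show ?case using seq.span_zero by (simp add: zero_fun_def)
next
  case (step c x y)
  have "(\<lambda>i. \<mu> i * x i) \<in> seq.span K"
    using T_K[OF step(1), of 1] by (auto simp: T_def intro: seq.span_base)
  from seq.span_add[OF seq.span_scale[OF this, of c] step(2)]
  have "(\<lambda>i. c * (\<mu> i * x i)) + (\<lambda>i. \<mu> i * y i) \<in> seq.span K" .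
  moreover have "(\<lambda>i. c * (\<mu> i * x i)) + (\<lambda>i. \<mu> i * y i) = (\<lambda>i. \<mu> i * (fscale c x + y) i)"
    by (auto simp: algebra_simps)
  ultimately show ?case by simp
qed

definition component :: "real \<Rightarrow> (nat \<Rightarrow> real) \<Rightarrow> nat \<Rightarrow> real"
  where "component \<nu> x = (\<lambda>i. if \<mu> i = \<nu> then x i else 0)"

text \<open>
  An invariant subspace contains the eigencomponents of each of its vectors. By induction on the number
  of eigenvalues involved: \<open>T 1 x - \<kappa> x\<close> lies in the subspace, has no \<open>\<kappa>\<close>-component, and its other
  components are those of \<open>x\<close> up to the nonzero factors \<open>\<rho> - \<kappa>\<close>; the \<open>\<kappa>\<close>-component is what remains
  of \<open>x\<close>.
\<close>

lemma eigencomponents_in_W: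
  assumes "finite E" "\<And>i. x i \<noteq> 0 \<Longrightarrow> \<mu> i \<in> E" "x \<in> W"
  shows "component \<nu> x \<in> W"
  using assms
proof (induction E arbitrary: x \<nu> rule: finite_induct)
  case empty
  then have "component \<nu> x = 0" by (auto simp: component_def fun_eq_iff)
  then show ?case using W_zero by (simp only:)
next
  case (insert \<kappa> E)
  define y where "y = (\<lambda>i. \<mu> i * x i) - fscale \<kappa> x"
  have y: "y \<in> W"
    unfolding y_def by (intro W_diff W_T W_scale insert.prems)
  have yi: "y i = (\<mu> i - \<kappa>) * x i" for i
    by (simp add: y_def algebra_simps)
  have y_supp: "\<mu> i \<in> E" if "y i \<noteq> 0" for i
    using that insert.prems(1)[of i] by (auto simp: yi)
  have other: "component \<rho> x \<in> W" if "\<rho> \<noteq> \<kappa>" for \<rho>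
  proof -
    have "fscale (1 / (\<rho> - \<kappa>)) (component \<rho> y) \<in> W"
      by (intro W_scale insert.IH y_supp y)
    moreover have "fscale (1 / (\<rho> - \<kappa>)) (component \<rho> y) = component \<rho> x"
      using that by (auto simp: component_def yi fun_eq_iff)
    ultimately show ?thesis by simp
  qed
  show ?case
  proof (cases "\<nu> = \<kappa>")
    case True
    have "x - (\<Sum>\<rho>\<in>E. component \<rho> x) \<in> W"
      using insert.hyps by (intro W_diff W_sum other insert.prems) auto
    moreover have "x - (\<Sum>\<rho>\<in>E. component \<rho> x) = component \<kappa> x"
    proof
      fix i
      have "(\<Sum>\<rho>\<in>E. component \<rho> x) i = (\<Sum>\<rho>\<in>E. if \<rho> = \<mu> i then x i else 0)"
        unfolding component_def sum_fun_apply by (intro sum.cong) auto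
      also have "\<dots> = (if \<mu> i \<in> E then x i else 0)"
        using insert.hyps by (simp add: sum.delta)
      finally have s: "(\<Sum>\<rho>\<in>E. component \<rho> x) i = (if \<mu> i \<in> E then x i else 0)" .
      show "(x - (\<Sum>\<rho>\<in>E. component \<rho> x)) i = component \<kappa> x i"
        using insert.prems(1)[of i] insert.hyps s by (auto simp: component_def)
    qed
    ultimately show ?thesis using True by simp
  qed (rule other)
qed

text \<open>
  The distance, in the \<open>\<nu>\<close>-eigenspace, to the real span of \<open>K\<close>. It is a seminorm that vanishes on
  \<open>K\<close>, hence a function on \<open>\<Lambda> / K\<close>, and \<open>T s\<close> multiplies it by exactly \<open>\<bar>\<nu>\<bar> powi s\<close>. These seminorms
  stand in for eigencoordinates of the automorphism that \<open>\<Lambda> / K\<close> inherits, without choosing a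
  complement of \<open>K\<close> and without splitting off the torsion of \<open>\<Lambda> / K\<close>.
\<close>

definition eigendist :: "real \<Rightarrow> (nat \<Rightarrow> real) \<Rightarrow> real"
  where "eigendist \<nu> x = (INF w\<in>W. \<Sum>i | i < n \<and> \<mu> i = \<nu>. \<bar>x i - w i\<bar>)"

lemma eigendist_le: "w \<in> W \<Longrightarrow> eigendist \<nu> x \<le> (\<Sum>i | i < n \<and> \<mu> i = \<nu>. \<bar>x i - w i\<bar>)"
  unfolding eigendist_def by (rule cINF_lower) (auto intro!: bdd_belowI[of _ 0] sum_nonneg)

lemma eigendist_less_witness:
  assumes "eigendist \<nu> x < r"
  obtains w where "w \<in> W" "(\<Sum>i | i < n \<and> \<mu> i = \<nu>. \<bar>x i - w i\<bar>) < r"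
proof -
  have "\<exists>w\<in>W. (\<Sum>i | i < n \<and> \<mu> i = \<nu>. \<bar>x i - w i\<bar>) < r"
    using assms W_zero unfolding eigendist_def
    by (subst (asm) cINF_less_iff) (auto intro!: bdd_belowI[of _ 0] sum_nonneg)
  then show thesis using that by auto
qed

lemma eigendist_nonneg: "eigendist \<nu> x \<ge> 0"
  unfolding eigendist_def using W_zero by (intro cINF_greatest) (auto intro: sum_nonneg)

lemma eigendist_triangle: "eigendist \<nu> (x + y) \<le> eigendist \<nu> x + eigendist \<nu> y"
proof (rule field_le_epsilon)
  fix e :: real assume e: "e > 0"
  obtain w where w: "w \<in> W" "(\<Sum>i | i < n \<and> \<mu> i = \<nu>. \<bar>x i - w i\<bar>) < eigendist \<nu> x + e / 2"
    using eigendist_less_witness[of \<nu> x "eigendist \<nu> x + e / 2"] e by auto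
  obtain v where v: "v \<in> W" "(\<Sum>i | i < n \<and> \<mu> i = \<nu>. \<bar>y i - v i\<bar>) < eigendist \<nu> y + e / 2"
    using eigendist_less_witness[of \<nu> y "eigendist \<nu> y + e / 2"] e by auto
  have "eigendist \<nu> (x + y) \<le> (\<Sum>i | i < n \<and> \<mu> i = \<nu>. \<bar>(x + y) i - (w + v) i\<bar>)"
    by (intro eigendist_le W_add w v)
  also have "\<dots> \<le> (\<Sum>i | i < n \<and> \<mu> i = \<nu>. \<bar>x i - w i\<bar> + \<bar>y i - v i\<bar>)"
    by (rule sum_mono) auto
  also have "\<dots> \<le> eigendist \<nu> x + eigendist \<nu> y + e"
    using w v by (simp add: sum.distrib)
  finally show "eigendist \<nu> (x + y) \<le> eigendist \<nu> x + eigendist \<nu> y + e" .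
qed

lemma eigendist_W: "w \<in> W \<Longrightarrow> eigendist \<nu> w = 0"
  using eigendist_le[of w \<nu> w] eigendist_nonneg[of \<nu> w] by simp

text \<open>
  \<open>W\<close> is closed under scaling, so multiplying the \<open>\<nu>\<close>-eigenspace by \<open>\<nu> powi s\<close> scales distances to
  \<open>W\<close>. The reverse inequality is the same statement for \<open>- s\<close>.
\<close>

lemma eigendist_T_le: "eigendist \<nu> (T s x) \<le> \<bar>\<nu>\<bar> powi s * eigendist \<nu> x"
proof (cases "\<bar>\<nu>\<bar> powi s = 0")
  case True
  then have "\<nu> = 0" by (auto simp: power_int_eq_0_iff)
  then have "{i. i < n \<and> \<mu> i = \<nu>} = {}" using eigenvalue_nonzero by auto
  then have "eigendist \<nu> y \<le> 0" for y
    using eigendist_le[OF W_zero, of \<nu> y] by (simp only: sum.empty)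
  then show ?thesis using eigendist_nonneg[of \<nu> x] True by simp
next
  case False
  then have p: "\<bar>\<nu>\<bar> powi s > 0" by (simp add: order_less_le)
  show ?thesis
  proof (rule field_le_epsilon)
    fix e :: real assume e: "e > 0"
    define d where "d = e / \<bar>\<nu>\<bar> powi s"
    have d: "d > 0" using e p by (simp add: d_def)
    obtain w where w: "w \<in> W" "(\<Sum>i | i < n \<and> \<mu> i = \<nu>. \<bar>x i - w i\<bar>) < eigendist \<nu> x + d"
      using eigendist_less_witness[of \<nu> x "eigendist \<nu> x + d"] d by auto
    have "eigendist \<nu> (T s x) \<le> (\<Sum>i | i < n \<and> \<mu> i = \<nu>. \<bar>T s x i - fscale (\<nu> powi s) w i\<bar>)"
      by (intro eigendist_le W_scale w)
    also have "\<dots> = (\<Sum>i | i < n \<and> \<mu> i = \<nu>. \<bar>\<nu>\<bar> powi s * \<bar>x i - w i\<bar>)"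
      by (intro sum.cong) (auto simp: T_def abs_mult power_int_abs right_diff_distrib[symmetric])
    also have "\<dots> \<le> \<bar>\<nu>\<bar> powi s * (eigendist \<nu> x + d)"
      unfolding sum_distrib_left[symmetric] using w p by (intro mult_left_mono) auto
    also have "\<dots> = \<bar>\<nu>\<bar> powi s * eigendist \<nu> x + e"
      using False by (simp add: d_def distrib_left)
    finally show "eigendist \<nu> (T s x) \<le> \<bar>\<nu>\<bar> powi s * eigendist \<nu> x + e" .
  qed
qed

lemma eigendist_T: "\<nu> \<noteq> 0 \<Longrightarrow> eigendist \<nu> (T s x) = \<bar>\<nu>\<bar> powi s * eigendist \<nu> x"
proof (rule antisym[OF eigendist_T_le])
  assume "\<nu> \<noteq> 0"
  then have p: "\<bar>\<nu>\<bar> powi s > 0" by (simp add: zero_less_power_int)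
  have "eigendist \<nu> x \<le> \<bar>\<nu>\<bar> powi (- s) * eigendist \<nu> (T s x)"
    using eigendist_T_le[of \<nu> "- s" "T s x"] T_add[of "- s" s x] by (simp add: T_0)
  then show "\<bar>\<nu>\<bar> powi s * eigendist \<nu> x \<le> eigendist \<nu> (T s x)"
    using p by (simp add: power_int_minus field_simps)
qed

lemma eigendist_uminus: "eigendist \<nu> (- x) = eigendist \<nu> x"
proof -
  have le: "eigendist \<nu> (- x) \<le> eigendist \<nu> x" for x
  proof (rule field_le_epsilon)
    fix e :: real assume "e > 0"
    then obtain w where w: "w \<in> W" "(\<Sum>i | i < n \<and> \<mu> i = \<nu>. \<bar>x i - w i\<bar>) < eigendist \<nu> x + e"
      using eigendist_less_witness[of \<nu> x "eigendist \<nu> x + e"] by auto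
    have "eigendist \<nu> (- x) \<le> (\<Sum>i | i < n \<and> \<mu> i = \<nu>. \<bar>(- x) i - (0 - w) i\<bar>)"
      by (intro eigendist_le W_diff W_zero w)
    also have "\<dots> = (\<Sum>i | i < n \<and> \<mu> i = \<nu>. \<bar>x i - w i\<bar>)"
      by (intro sum.cong) auto
    finally show "eigendist \<nu> (- x) \<le> eigendist \<nu> x + e" using w by simp
  qed
  show ?thesis using le[of x] le[of "- x"] by simp
qed

lemma eigendist_cong_K: "x - y \<in> K \<Longrightarrow> eigendist \<nu> x = eigendist \<nu> y"
proof -
  assume "x - y \<in> K"
  then have "eigendist \<nu> (x - y) = 0" by (intro eigendist_W K_W)
  then show ?thesis
    using eigendist_triangle[of \<nu> "x - y" y] eigendist_triangle[of \<nu> "-(x - y)" x] eigendist_uminus[of \<nu> "x - y"]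
    by simp
qed

lemma finite_spanning_subset:
  obtains B where "finite B" "B \<subseteq> K" "W = seq.span B"
proof -
  obtain B where B: "B \<subseteq> K" "seq.independent B" "K \<subseteq> seq.span B"
    using seq.maximal_independent_subset[of K] by metis
  define U where "U = (\<lambda>j i. if i = j then 1 else (0::real)) ` {..<n}"
  have "K \<subseteq> seq.span U"
  proof
    fix x assume "x \<in> K"
    have "x = (\<Sum>j<n. fscale (x j) (\<lambda>i. if i = j then 1 else 0))"
    proof
      fix i
      have "(\<Sum>j<n. fscale (x j) (\<lambda>i. if i = j then 1 else 0)) i = (\<Sum>j<n. if i = j then x j else 0)"
        unfolding sum_fun_apply by (intro sum.cong) auto
      then show "x i = (\<Sum>j<n. fscale (x j) (\<lambda>i. if i = j then 1 else 0)) i"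
        using \<Lambda>_support[of x i] K_subset \<open>x \<in> K\<close> by auto
    qed
    also have "\<dots> \<in> seq.span U"
      by (intro seq.span_sum seq.span_scale seq.span_base) (auto simp: U_def)
    finally show "x \<in> seq.span U" .
  qed
  then have "finite B"
    using seq.independent_span_bound[of U B] B by (auto simp: U_def)
  moreover have "W = seq.span B"
    unfolding W_def using B by (metis seq.span_mono seq.span_span subset_antisym)
  ultimately show thesis using that B by auto
qed

text \<open>
  The seminorms jointly detect finiteness in \<open>\<Lambda> / K\<close>. If they are all bounded at \<open>x\<close>, then gluing the
  nearby vectors of \<open>W\<close> in the various eigenspaces, which stays inside \<open>W\<close>, yields one vector of \<open>W\<close>
  near \<open>x\<close>. Writing it in a finite basis taken from \<open>K\<close> and rounding the coefficients down moves it
  into \<open>K\<close> at bounded cost, so \<open>x\<close> is congruent modulo \<open>K\<close> to one of the finitely many lattice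
  points in a bounded box.
\<close>

lemma eigendist_bounded_finite_mod_K:
  obtains D where "finite D" "D \<subseteq> \<Lambda>"
    "\<And>x. x \<in> \<Lambda> \<Longrightarrow> (\<And>i. i < n \<Longrightarrow> eigendist (\<mu> i) x \<le> R) \<Longrightarrow> \<exists>d\<in>D. x - d \<in> K"
proof -
  obtain B where B: "finite B" "B \<subseteq> K" "W = seq.span B"
    by (rule finite_spanning_subset)
  define R' where "R' = R + 1 + (\<Sum>b\<in>B. \<Sum>i<n. \<bar>b i\<bar>)"
  define D where "D = {x \<in> \<Lambda>. \<forall>i<n. \<bar>x i\<bar> \<le> R'}"
  have "\<exists>d\<in>D. x - d \<in> K" if x: "x \<in> \<Lambda>" "\<And>i. i < n \<Longrightarrow> eigendist (\<mu> i) x \<le> R" for x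
  proof -
    let ?E = "\<mu> ` {..<n}"
    have "\<exists>w. w \<in> W \<and> (\<Sum>i | i < n \<and> \<mu> i = \<nu>. \<bar>x i - w i\<bar>) < R + 1" if "\<nu> \<in> ?E" for \<nu>
    proof -
      have "eigendist \<nu> x < R + 1" using x(2) that by force
      then show ?thesis by (rule eigendist_less_witness) auto
    qed
    then obtain w where w: "\<And>\<nu>. \<nu> \<in> ?E \<Longrightarrow> w \<nu> \<in> W"
        "\<And>\<nu>. \<nu> \<in> ?E \<Longrightarrow> (\<Sum>i | i < n \<and> \<mu> i = \<nu>. \<bar>x i - w \<nu> i\<bar>) < R + 1"
      by metis
    have W_support: "y i = 0" if "y \<in> W" "i \<ge> n" for y i
      using that(1) unfolding W_def
      by (induction rule: seq.span_induct_alt)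
        (use \<Lambda>_support[of _ i] K_subset that(2) in auto)
    define z where "z = (\<Sum>\<nu>\<in>?E. component \<nu> (w \<nu>))"
    have z: "z \<in> W"
      unfolding z_def
    proof (intro W_sum eigencomponents_in_W)
      fix \<nu> i assume "\<nu> \<in> ?E" "w \<nu> i \<noteq> 0"
      then show "\<mu> i \<in> ?E" using W_support[OF w(1)] by (meson image_eqI lessThan_iff not_le)
    qed (use w in auto)
    have z_i: "z i = w (\<mu> i) i" if "i < n" for i
    proof -
      have "z i = (\<Sum>\<nu>\<in>?E. if \<nu> = \<mu> i then w (\<mu> i) i else 0)"
        unfolding z_def component_def sum_fun_apply by (intro sum.cong) auto
      then show ?thesis using that by simp
    qed
    have near: "\<bar>x i - z i\<bar> \<le> R + 1" if i: "i < n" for i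
    proof -
      have "\<bar>x i - w (\<mu> i) i\<bar> \<le> (\<Sum>j | j < n \<and> \<mu> j = \<mu> i. \<bar>x j - w (\<mu> i) j\<bar>)"
        by (rule member_le_sum) (use i in auto)
      then show ?thesis using w(2)[of "\<mu> i"] i by (auto simp: z_i)
    qed
    obtain c where c: "z = (\<Sum>b\<in>B. fscale (c b) b)"
      using z B seq.span_finite[of B] by auto
    define k where "k = (\<Sum>b\<in>B. fscale (of_int \<lfloor>c b\<rfloor>) b)"
    have k: "k \<in> K"
      unfolding k_def using B by (intro additive_subgroup_sum additive_subgroup_int_scale K) auto
    have "\<bar>(x - k) i\<bar> \<le> R'" if i: "i < n" for i
    proof -
      have "\<bar>z i - k i\<bar> = \<bar>\<Sum>b\<in>B. (c b - of_int \<lfloor>c b\<rfloor>) * b i\<bar>"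
        by (simp add: c k_def sum_fun_apply sum_subtractf left_diff_distrib)
      also have "\<dots> \<le> (\<Sum>b\<in>B. \<bar>(c b - of_int \<lfloor>c b\<rfloor>) * b i\<bar>)"
        by (rule sum_abs)
      also have "\<dots> \<le> (\<Sum>b\<in>B. \<Sum>i<n. \<bar>b i\<bar>)"
      proof (rule sum_mono)
        fix b
        have f: "\<bar>c b - of_int \<lfloor>c b\<rfloor>\<bar> \<le> 1" by linarith
        have "\<bar>(c b - of_int \<lfloor>c b\<rfloor>) * b i\<bar> \<le> \<bar>b i\<bar>"
          unfolding abs_mult using mult_right_mono[OF f, of "\<bar>b i\<bar>"] by simp
        also have "\<dots> \<le> (\<Sum>i<n. \<bar>b i\<bar>)"
          by (rule member_le_sum) (use i in auto)
        finally show "\<bar>(c b - of_int \<lfloor>c b\<rfloor>) * b i\<bar> \<le> (\<Sum>i<n. \<bar>b i\<bar>)" .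
      qed
      finally show ?thesis using near[OF i] by (simp add: R'_def)
    qed
    then have "x - k \<in> D"
      using x(1) k K_subset \<Lambda> by (auto simp: D_def intro: additive_subgroup_diff)
    moreover have "x - (x - k) \<in> K" using k by simp
    ultimately show ?thesis by blast
  qed
  moreover have "finite D" unfolding D_def by (rule \<Lambda>_discrete)
  ultimately show thesis using that[of D] by (auto simp: D_def)
qed

section \<open>Expansion and the bound on cliques\<close>


text \<open>
  If \<open>f\<close> has no component in an expanding eigenspace, its forward orbit stays bounded in every seminorm
  and is therefore finite modulo \<open>K\<close>. By the pigeonhole principle \<open>f\<close> is periodic modulo \<open>K\<close>, so its
  full orbit, in both directions of time, is finite modulo \<open>K\<close> as well.
\<close>

lemma bounded_orbit_finite_mod_K:
  assumes f: "f \<in> \<Lambda>" and small: "\<And>i. i < n \<Longrightarrow> \<bar>\<mu> i\<bar> > 1 \<Longrightarrow> eigendist (\<mu> i) f = 0"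
  obtains D where "finite D" "\<And>s. \<exists>d\<in>D. T s f - d \<in> K"
proof -
  define R where "R = (\<Sum>i<n. eigendist (\<mu> i) f)"
  obtain D where D: "finite D" "D \<subseteq> \<Lambda>"
    "\<And>x. x \<in> \<Lambda> \<Longrightarrow> (\<And>i. i < n \<Longrightarrow> eigendist (\<mu> i) x \<le> R) \<Longrightarrow> \<exists>d\<in>D. x - d \<in> K"
    using eigendist_bounded_finite_mod_K[of R] by blast
  have "\<exists>d\<in>D. T (int m) f - d \<in> K" for m
  proof (rule D(3)[OF T_\<Lambda>[OF f]])
    fix i assume i: "i < n"
    have "eigendist (\<mu> i) (T (int m) f) = \<bar>\<mu> i\<bar> ^ m * eigendist (\<mu> i) f"
      by (simp add: eigendist_T eigenvalue_nonzero)
    also have "\<dots> \<le> eigendist (\<mu> i) f"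
    proof (cases "\<bar>\<mu> i\<bar> > 1")
      case False
      then show ?thesis using eigendist_nonneg[of "\<mu> i" f] by (simp add: mult_left_le_one_le power_le_one)
    qed (simp add: small[OF i])
    also have "\<dots> \<le> R"
      unfolding R_def by (rule member_le_sum) (use i eigendist_nonneg in auto)
    finally show "eigendist (\<mu> i) (T (int m) f) \<le> R" .
  qed
  then obtain d where d: "\<And>m. d m \<in> D" "\<And>m. T (int m) f - d m \<in> K"
    by metis
  have "\<not> inj d"
    using finite_subset[of "range d" D] d(1) D(1) range_inj_infinite by blast
  then obtain u v where uv: "u < v" "d u = d v"
    unfolding inj_def by (metis linorder_neqE_nat)
  define p where "p = int v - int u"
  have p: "p > 0" using uv by (simp add: p_def)
  have "T (int v) f - T (int u) f \<in> K"
    using additive_subgroup_diff[OF K d(2)[of v] d(2)[of u]] uv by simp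
  from T_K[OF this, of "- int u"] have period: "T p f - f \<in> K"
    by (simp add: T_minus T_add[symmetric] p_def T_0)
  have multiple: "T (p * q) f - f \<in> K" for q
  proof (induction q rule: int_induct[where k = 0])
    case base
    then show ?case using additive_subgroup_zero[OF K] by (simp add: T_0 zero_fun_def)
  next
    case (step1 i)
    have "T (p * (i + 1)) f - f = T p (T (p * i) f - f) + (T p f - f)"
      by (simp add: T_minus T_add[symmetric] algebra_simps)
    then show ?case using additive_subgroup_add[OF K T_K[OF step1(2)] period] by metis
  next
    case (step2 i)
    have "T (p * (i - 1)) f - f = T (- p) ((T (p * i) f - f) - (T p f - f))"
      by (simp add: T_minus T_add[symmetric] T_0 algebra_simps)
    then show ?case using T_K[OF additive_subgroup_diff[OF K step2(2) period]] by metis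
  qed
  show thesis
  proof (rule that)
    show "finite ((\<lambda>j. T j f) ` {0..<p})" by simp
    show "\<exists>d\<in>(\<lambda>j. T j f) ` {0..<p}. T s f - d \<in> K" for s
    proof (intro bexI imageI)
      have "T s f - T (s mod p) f = T (s mod p) (T (p * (s div p)) f - f)"
        by (simp add: T_minus T_add[symmetric])
      then show "T s f - T (s mod p) f \<in> K" using T_K[OF multiple] by metis
    qed (use p in auto)
  qed
qed

text \<open>
  Elements in pairwise distinct classes modulo \<open>K\<close> inject into any set of representatives.
\<close>

lemma card_le_finite_mod_K:
  assumes "finite E" "\<And>x y. x \<in> A \<Longrightarrow> y \<in> A \<Longrightarrow> x \<noteq> y \<Longrightarrow> x - y \<notin> K"
  shows "card {x \<in> A. \<exists>e\<in>E. x - a - e \<in> K} \<le> card E"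
proof -
  define e where "e x = (SOME e. e \<in> E \<and> x - a - e \<in> K)" for x
  have e: "e x \<in> E \<and> x - a - e x \<in> K" if "\<exists>e\<in>E. x - a - e \<in> K" for x
    unfolding e_def using someI_ex[of "\<lambda>e. e \<in> E \<and> x - a - e \<in> K"] that by blast
  show ?thesis
  proof (rule card_inj_on_le[where f = e])
    show "inj_on e {x \<in> A. \<exists>e\<in>E. x - a - e \<in> K}"
    proof (rule inj_onI)
      fix x y assume x: "x \<in> {x \<in> A. \<exists>e\<in>E. x - a - e \<in> K}"
        and y: "y \<in> {x \<in> A. \<exists>e\<in>E. x - a - e \<in> K}" and eq: "e x = e y"
      have "x - a - e x \<in> K" "y - a - e y \<in> K" using e x y by simp_all
      from additive_subgroup_diff[OF K this]
      have "(x - a - e x) - (y - a - e y) \<in> K" .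
      then have "x - y \<in> K" by (simp add: eq)
      then show "x = y" using assms(2) x y by auto
    qed
  qed (use e assms(1) in auto)
qed

text \<open>
  Only finitely many pairs of an expanding eigenvalue and a vector of \<open>F\<close> occur, so one exponent \<open>C\<close>
  serves for all of them.
\<close>

lemma expansion_uniform:
  assumes "finite F"
  obtains C where "\<And>i f j. i < n \<Longrightarrow> f \<in> F \<Longrightarrow> \<bar>\<mu> i\<bar> > 1 \<Longrightarrow> eigendist (\<mu> i) f \<noteq> 0 \<Longrightarrow> C \<le> j
    \<Longrightarrow> \<bar>\<mu> i\<bar> ^ j * eigendist (\<mu> i) f > R"
proof -
  define P where "P = {(i, f). i < n \<and> f \<in> F \<and> \<bar>\<mu> i\<bar> > 1 \<and> eigendist (\<mu> i) f \<noteq> 0}"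
  have "finite P"
    by (rule finite_subset[of _ "{..<n} \<times> F"]) (use assms in \<open>auto simp: P_def\<close>)
  moreover have "\<forall>\<^sub>F j in sequentially. \<bar>\<mu> (fst q)\<bar> ^ j * eigendist (\<mu> (fst q)) (snd q) > R"
    if q: "q \<in> P" for q
  proof -
    have "\<bar>\<mu> (fst q)\<bar> > 1" "eigendist (\<mu> (fst q)) (snd q) > 0"
      using q eigendist_nonneg[of "\<mu> (fst q)" "snd q"] by (auto simp: P_def)
    moreover obtain m where "R / eigendist (\<mu> (fst q)) (snd q) < \<bar>\<mu> (fst q)\<bar> ^ m"
      using real_arch_pow calculation(1) by blast
    moreover have "\<bar>\<mu> (fst q)\<bar> ^ m \<le> \<bar>\<mu> (fst q)\<bar> ^ j" if "m \<le> j" for j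
      by (rule power_increasing) (use that calculation(1) in auto)
    ultimately show ?thesis
      unfolding eventually_sequentially
      by (intro exI[of _ m]) (metis pos_divide_less_eq less_le_trans)
  qed
  ultimately have "\<forall>\<^sub>F j in sequentially. \<forall>q\<in>P. \<bar>\<mu> (fst q)\<bar> ^ j * eigendist (\<mu> (fst q)) (snd q) > R"
    by (intro eventually_ball_finite) auto
  then obtain C where "\<And>j. C \<le> j \<Longrightarrow> \<forall>q\<in>P. \<bar>\<mu> (fst q)\<bar> ^ j * eigendist (\<mu> (fst q)) (snd q) > R"
    by (auto simp: eventually_sequentially)
  then show thesis using that[of C] by (auto simp: P_def)
qed

text \<open>
  The heart of the proof. Suppose that all differences of \<open>A\<close> are, modulo \<open>K\<close>, of the form \<open>T s f\<close>
  with \<open>f \<in> F\<close>. Differences coming from vectors \<open>f\<close> with a finite orbit take finitely many values. If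
  another kind occurs, pick one, \<open>a - b\<close>, whose exponent \<open>S\<close> is largest, and an expanding eigenvalue
  \<open>\<nu>\<close> seen by its \<open>f\<close>. By the triangle inequality each further point \<open>c\<close> is at \<open>\<nu>\<close>-distance at least
  half of that of \<open>a - b\<close> from \<open>a\<close> or from \<open>b\<close>. A difference \<open>T t g\<close> that large needs an exponent \<open>t\<close>
  not far below \<open>S\<close>, and \<open>t \<le> S\<close> by maximality. Hence \<open>c\<close> lies in one of boundedly many classes near
  \<open>a\<close> or near \<open>b\<close>; the number of classes depends on \<open>F\<close> but not on \<open>S\<close>, because shifting by
  \<open>T S\<close> normalizes \<open>S\<close> to \<open>0\<close>.
\<close>

lemma clique_bound:
  assumes F: "finite F" "F \<subseteq> \<Lambda>"
  shows "\<exists>M. \<forall>A. finite A \<longrightarrow>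
    (\<forall>x\<in>A. \<forall>y\<in>A. x \<noteq> y \<longrightarrow> x - y \<notin> K \<and> (\<exists>s. \<exists>f\<in>F. x - y - T s f \<in> K)) \<longrightarrow> card A \<le> M"
proof -
  define F0 where "F0 = {f \<in> F. \<forall>i<n. \<bar>\<mu> i\<bar> > 1 \<longrightarrow> eigendist (\<mu> i) f = 0}"
  have "\<forall>f\<in>F0. \<exists>D. finite D \<and> (\<forall>s. \<exists>d\<in>D. T s f - d \<in> K)"
  proof
    fix f assume f: "f \<in> F0"
    show "\<exists>D. finite D \<and> (\<forall>s. \<exists>d\<in>D. T s f - d \<in> K)"
      by (rule bounded_orbit_finite_mod_K[of f]) (use f F in \<open>auto simp: F0_def\<close>)
  qed
  then obtain O' where O': "\<And>f. f \<in> F0 \<Longrightarrow> finite (O' f)"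
    "\<And>f s. f \<in> F0 \<Longrightarrow> \<exists>d\<in>O' f. T s f - d \<in> K" by metis
  define D0 where "D0 = (\<Union>f\<in>F0. O' f)"
  have D0: "finite D0" "\<And>f s. f \<in> F0 \<Longrightarrow> \<exists>d\<in>D0. T s f - d \<in> K"
    using O' F unfolding D0_def by (auto simp: F0_def)
  define R where "R = (\<Sum>f\<in>F. \<Sum>i<n. eigendist (\<mu> i) f)"
  have R: "eigendist (\<mu> i) f \<le> R" if "f \<in> F" "i < n" for i f
  proof -
    have "eigendist (\<mu> i) f \<le> (\<Sum>i<n. eigendist (\<mu> i) f)"
      by (rule member_le_sum) (use that eigendist_nonneg in auto)
    also have "\<dots> \<le> R"
      unfolding R_def by (rule member_le_sum) (use that F eigendist_nonneg in \<open>auto intro: sum_nonneg\<close>)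
    finally show ?thesis .
  qed
  obtain C where C: "\<And>i f j. i < n \<Longrightarrow> f \<in> F \<Longrightarrow> \<bar>\<mu> i\<bar> > 1 \<Longrightarrow> eigendist (\<mu> i) f \<noteq> 0 \<Longrightarrow> C \<le> j
    \<Longrightarrow> \<bar>\<mu> i\<bar> ^ j * eigendist (\<mu> i) f > 2 * R"
    using expansion_uniform[OF F(1), of "2 * R"] by blast
  \<comment> \<open>the possible differences with exponent between \<open>- C\<close> and \<open>0\<close>, which is the range left after
    normalizing the largest exponent to \<open>0\<close>\<close>
  define D1 where "D1 = (\<lambda>(j, f). T (- int j) f) ` ({..<C} \<times> F)"
  have D1: "finite D1" using F by (simp add: D1_def)
  show ?thesis
  proof (intro exI[of _ "2 + 2 * (card D0 + card D1)"] allI impI)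
    fix A
    assume A: "finite A"
      and pairs: "\<forall>x\<in>A. \<forall>y\<in>A. x \<noteq> y \<longrightarrow> x - y \<notin> K \<and> (\<exists>s. \<exists>f\<in>F. x - y - T s f \<in> K)"
    obtain s f where sf: "\<And>x y. x \<in> A \<Longrightarrow> y \<in> A \<Longrightarrow> x \<noteq> y \<Longrightarrow> f x y \<in> F"
      "\<And>x y. x \<in> A \<Longrightarrow> y \<in> A \<Longrightarrow> x \<noteq> y \<Longrightarrow> x - y - T (s x y) (f x y) \<in> K"
      using pairs by metis
    have near: "\<exists>d\<in>D0. x - y - d \<in> K" if xy: "x \<in> A" "y \<in> A" "x \<noteq> y" "f x y \<in> F0" for x y
    proof -
      obtain d where d: "d \<in> D0" "T (s x y) (f x y) - d \<in> K" using D0(2)[OF xy(4), of "s x y"] by blast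
      show ?thesis
        using additive_subgroup_add[OF K sf(2)[OF xy(1-3)] d(2)]
        by (intro bexI[OF _ d(1)]) (simp add: algebra_simps)
    qed
    \<comment> \<open>the points of \<open>A\<close> whose class differs from that of \<open>a\<close> by an element of \<open>E\<close>\<close>
    define cl where "cl E a = {x \<in> A. \<exists>e\<in>E. x - a - e \<in> K}" for E a
    have cl: "card (cl E a) \<le> card E" if "finite E" for E a
      unfolding cl_def by (rule card_le_finite_mod_K) (use that pairs in auto)
    have cl_finite: "finite (cl E a)" for E a using A by (simp add: cl_def)
    define Q where "Q = {(x, y) \<in> A \<times> A. x \<noteq> y \<and> f x y \<notin> F0}"
    have Q: "finite Q" by (rule finite_subset[of _ "A \<times> A"]) (use A in \<open>auto simp: Q_def\<close>)
    show "card A \<le> 2 + 2 * (card D0 + card D1)"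
    proof (cases "Q = {}")
      case True
      show ?thesis
      proof (cases "A = {}")
        case False
        then obtain a where a: "a \<in> A" by auto
        have "A \<subseteq> insert a (cl D0 a)"
          using near[OF _ a] True a by (auto simp: Q_def cl_def)
        then have "card A \<le> card (insert a (cl D0 a))"
          by (intro card_mono) (auto simp: cl_finite)
        also have "\<dots> \<le> 1 + card D0"
          using cl[OF D0(1), of a] card_insert_le_m1[of "Suc (card D0)" "cl D0 a" a] by simp
        finally show ?thesis by simp
      qed simp
    next
      case False
      define S where "S = Max ((\<lambda>(x, y). s x y) ` Q)"
      have "S \<in> (\<lambda>(x, y). s x y) ` Q"
        unfolding S_def using Q False by (intro Max_in) auto
      then obtain a b where ab: "(a, b) \<in> Q" "s a b = S" by auto
      have S_max: "s x y \<le> S" if "(x, y) \<in> Q" for x y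
        unfolding S_def using Q that by (intro Max_ge) force+
      have ab': "a \<in> A" "b \<in> A" "a \<noteq> b" "f a b \<in> F" "f a b \<notin> F0"
        using ab(1) sf(1) by (auto simp: Q_def)
      then obtain i where i: "i < n" "\<bar>\<mu> i\<bar> > 1" "eigendist (\<mu> i) (f a b) \<noteq> 0"
        by (auto simp: F0_def)
      let ?\<nu> = "\<mu> i"
      have nz: "?\<nu> \<noteq> 0" by (rule eigenvalue_nonzero)
      have Nab: "eigendist ?\<nu> (a - b) = \<bar>?\<nu>\<bar> powi S * eigendist ?\<nu> (f a b)"
        using eigendist_cong_K[OF sf(2)[OF ab'(1-3)]] eigendist_T[OF nz] ab(2) by simp
      define E where "E = D0 \<union> T S ` D1"
      have E: "finite E" "card E \<le> card D0 + card D1"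
        using D0 D1 card_Un_le[of D0 "T S ` D1"] card_image_le[OF D1, of "T S"] by (auto simp: E_def)
      have far: "c \<in> cl E x"
        if c: "c \<in> A" "x \<in> A" "c \<noteq> x" and big: "2 * eigendist ?\<nu> (c - x) \<ge> eigendist ?\<nu> (a - b)" for c x
      proof (cases "f c x \<in> F0")
        case True
        then obtain d where "d \<in> D0" "c - x - d \<in> K" using near[OF c(1-3)] by blast
        then show ?thesis using c(1) by (auto simp: cl_def E_def)
      next
        case False
        define t where "t = s c x"
        define g where "g = f c x"
        have "(c, x) \<in> Q" using False c by (auto simp: Q_def)
        then have t: "t \<le> S" using S_max by (simp add: t_def)
        have g: "g \<in> F" "c - x - T t g \<in> K" using sf c by (auto simp: g_def t_def)
        define j where "j = nat (S - t)"
        have St: "S = t + int j" using t by (simp add: j_def)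
        have "2 * (\<bar>?\<nu>\<bar> powi t * eigendist ?\<nu> g) \<ge> \<bar>?\<nu>\<bar> powi S * eigendist ?\<nu> (f a b)"
          using big eigendist_cong_K[OF g(2)] eigendist_T[OF nz] Nab by simp
        then have "\<bar>?\<nu>\<bar> powi t * (\<bar>?\<nu>\<bar> ^ j * eigendist ?\<nu> (f a b)) \<le> \<bar>?\<nu>\<bar> powi t * (2 * eigendist ?\<nu> g)"
          using nz by (simp add: St power_int_add mult_ac)
        then have "\<bar>?\<nu>\<bar> ^ j * eigendist ?\<nu> (f a b) \<le> 2 * eigendist ?\<nu> g"
          using nz by (subst (asm) mult_le_cancel_left_pos) (auto simp: zero_less_power_int)
        also have "\<dots> \<le> 2 * R" using R[OF g(1) i(1)] by simp
        finally have "j < C" using C[OF i(1) ab'(4) i(2,3), of j] by (meson not_le)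
        moreover have "T t g = T S (T (- int j) g)"
          by (simp add: T_add[symmetric] St)
        ultimately show ?thesis
          using g c(1) unfolding cl_def E_def D1_def by force
      qed
      have "A \<subseteq> {a, b} \<union> (cl E a \<union> cl E b)"
      proof
        fix c assume c: "c \<in> A"
        have "eigendist ?\<nu> (a - b) \<le> eigendist ?\<nu> (c - a) + eigendist ?\<nu> (c - b)"
          using eigendist_triangle[of ?\<nu> "a - c" "c - b"] eigendist_uminus[of ?\<nu> "c - a"] by simp
        then have "2 * eigendist ?\<nu> (c - a) \<ge> eigendist ?\<nu> (a - b) \<or> 2 * eigendist ?\<nu> (c - b) \<ge> eigendist ?\<nu> (a - b)"
          by linarith
        then show "c \<in> {a, b} \<union> (cl E a \<union> cl E b)" using far c ab' by auto
      qed
      then have "card A \<le> card ({a, b} \<union> (cl E a \<union> cl E b))"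
        by (intro card_mono) (auto simp: cl_finite)
      also have "\<dots> \<le> 2 + (card E + card E)"
        using card_Un_le[of "{a, b}" "cl E a \<union> cl E b"] card_Un_le[of "cl E a" "cl E b"]
          cl[OF E(1), of a] cl[OF E(1), of b] ab'(3) by simp
      finally show ?thesis using E(2) by simp
    qed
  qed
qed

end

section \<open>Word balls and bounded packing\<close>

text \<open>
  Without this, the least word length of an element could be the least element of an empty set, an
  arbitrary number, and a word ball would not need to be finite.
\<close>

lemma (in group) generate_words:
  assumes "S \<subseteq> carrier G" "g \<in> generate G S"
  shows "\<exists>ws. set ws \<subseteq> S \<union> m_inv G ` S \<and> foldr (\<otimes>) ws \<one> = g"
  using assms(2)
proof (induction rule: generate.induct)
  case one
  show ?case by (intro exI[of _ "[]"]) simp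
next
  case (incl h)
  then show ?case using assms(1) by (intro exI[of _ "[h]"]) auto
next
  case (inv h)
  then show ?case using assms(1) by (intro exI[of _ "[inv h]"]) auto
next
  case (eng g h)
  then obtain us vs where us: "set us \<subseteq> S \<union> m_inv G ` S" "foldr (\<otimes>) us \<one> = g"
    and vs: "set vs \<subseteq> S \<union> m_inv G ` S" "foldr (\<otimes>) vs \<one> = h" by auto
  have letters: "S \<union> m_inv G ` S \<subseteq> carrier G" using assms(1) by auto
  have word: "foldr (\<otimes>) ws \<one> \<in> carrier G" if "set ws \<subseteq> carrier G" for ws
    using that by (induction ws) auto
  have h: "h \<in> carrier G" using word[of vs] vs letters by blast
  have "foldr (\<otimes>) ws h = foldr (\<otimes>) ws \<one> \<otimes> h" if "set ws \<subseteq> carrier G" for ws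
    using that
  proof (induction ws)
    case Nil
    show ?case using h by simp
  next
    case (Cons w ws)
    then show ?case using word[of ws] h by (auto simp: m_assoc)
  qed
  then have "foldr (\<otimes>) us h = g \<otimes> h" using us letters by auto
  then show ?case using us vs by (intro exI[of _ "us @ vs"]) auto
qed

lemma (in group) finite_word_ball:
  assumes "finite_generating_set G S"
  shows "finite {g \<in> carrier G. word_length G S g < r}"
proof -
  let ?A = "S \<union> m_inv G ` S"
  have "finite ?A" using assms by (auto simp: finite_generating_set_def)
  then have "finite {ws. set ws \<subseteq> ?A \<and> length ws \<le> r}"
    by (rule finite_lists_length_le)
  moreover have "{g \<in> carrier G. word_length G S g < r} \<subseteq>
      (\<lambda>ws. foldr (\<otimes>) ws \<one>) ` {ws. set ws \<subseteq> ?A \<and> length ws \<le> r}"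
  proof
    fix g assume g: "g \<in> {g \<in> carrier G. word_length G S g < r}"
    let ?P = "\<lambda>k. \<exists>ws. set ws \<subseteq> ?A \<and> length ws = k \<and> foldr (\<otimes>) ws \<one> = g"
    have "\<exists>k. ?P k"
      using generate_words[of S g] assms g by (auto simp: finite_generating_set_def)
    then have "?P (word_length G S g)"
      unfolding word_length_def by (rule LeastI_ex)
    then show "g \<in> (\<lambda>ws. foldr (\<otimes>) ws \<one>) ` {ws. set ws \<subseteq> ?A \<and> length ws \<le> r}"
      using g by fastforce
  qed
  ultimately show ?thesis by (rule finite_surj)
qed

text \<open>
  The only property of the word metric that matters is that balls are finite: two cosets at distance
  less than \<open>r\<close> contain points whose quotient lies in the ball of radius \<open>r\<close>. So it suffices to
  bound, for each finite set \<open>B\<close>, the families of cosets that are pairwise \<open>B\<close>-close.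
\<close>

lemma (in group) bounded_packing_wrtI:
  assumes S: "finite_generating_set G S" and H: "subgroup H G"
    and bound: "\<And>B. finite B \<Longrightarrow> B \<subseteq> carrier G \<Longrightarrow> \<exists>M. \<forall>C. finite C \<and> C \<subseteq> lcosets H \<and>
      (\<forall>X\<in>C. \<forall>Y\<in>C. X \<noteq> Y \<longrightarrow> (\<exists>x\<in>X. \<exists>y\<in>Y. inv x \<otimes> y \<in> B)) \<longrightarrow> card C \<le> M"
  shows "bounded_packing_wrt G S H"
  unfolding bounded_packing_wrt_def
proof (intro allI impI)
  fix r :: real assume "r > 0"
  define B where "B = {g \<in> carrier G. word_length G S g < nat \<lceil>r\<rceil>}"
  have "finite B" "B \<subseteq> carrier G"
    unfolding B_def using finite_word_ball[OF S] by auto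
  then obtain M where M: "\<And>C. finite C \<Longrightarrow> C \<subseteq> lcosets H \<Longrightarrow>
      (\<And>X Y. X \<in> C \<Longrightarrow> Y \<in> C \<Longrightarrow> X \<noteq> Y \<Longrightarrow> \<exists>x\<in>X. \<exists>y\<in>Y. inv x \<otimes> y \<in> B) \<Longrightarrow> card C \<le> M"
    using bound by meson
  show "\<exists>N. \<forall>C. C \<subseteq> lcosets H \<and> card C = N \<longrightarrow>
      (\<exists>X\<in>C. \<exists>Y\<in>C. X \<noteq> Y \<and> r \<le> real (word_setdist G S X Y))"
  proof (intro exI[of _ "Suc M"] allI impI, rule ccontr)
    fix C assume C: "C \<subseteq> lcosets H \<and> card C = Suc M"
      and close: "\<not> (\<exists>X\<in>C. \<exists>Y\<in>C. X \<noteq> Y \<and> r \<le> real (word_setdist G S X Y))"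
    have "card C \<le> M"
    proof (rule M)
      show "finite C" using C card.infinite by fastforce
      fix X Y assume XY: "X \<in> C" "Y \<in> C" "X \<noteq> Y"
      have coset: "Z \<subseteq> carrier G \<and> Z \<noteq> {}" if "Z \<in> lcosets H" for Z
        using that subgroup.subset[OF H] subgroup.one_closed[OF H]
        unfolding LCOSETS_def l_coset_def by blast
      have sub: "X \<subseteq> carrier G" "Y \<subseteq> carrier G" and "X \<noteq> {}" "Y \<noteq> {}"
        using C XY coset by blast+
      then have "(\<lambda>(x, y). word_dist G S x y) ` (X \<times> Y) \<noteq> {}" by auto
      from Inf_nat_def1[OF this] obtain x y
        where xy: "x \<in> X" "y \<in> Y" "word_setdist G S X Y = word_dist G S x y"
        by (auto simp: word_setdist_def)
      have "real (word_dist G S x y) < r" using close XY xy by force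
      then have "word_length G S (inv x \<otimes> y) < nat \<lceil>r\<rceil>"
        unfolding word_dist_def by linarith
      then show "\<exists>x\<in>X. \<exists>y\<in>Y. inv x \<otimes> y \<in> B"
        using xy sub unfolding B_def by blast
    qed (use C in auto)
    then show False using C by simp
  qed
qed

lemma finite_bounded_int_vecs: "finite {v \<in> carrier_vec n. \<forall>j<n. \<bar>real_of_int (v $ j)\<bar> \<le> c}"
proof -
  have "{v \<in> carrier_vec n. \<forall>j<n. \<bar>real_of_int (v $ j)\<bar> \<le> c}
      \<subseteq> vec n ` ({..<n} \<rightarrow>\<^sub>E {- \<lceil>c\<rceil>..\<lceil>c\<rceil>})"
  proof
    fix v assume v: "v \<in> {v \<in> carrier_vec n. \<forall>j<n. \<bar>real_of_int (v $ j)\<bar> \<le> c}"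
    then have "v $ j \<in> {- \<lceil>c\<rceil>..\<lceil>c\<rceil>}" if "j < n" for j
    proof -
      have "\<bar>real_of_int (v $ j)\<bar> \<le> c" using v that by simp
      then show ?thesis by (auto simp: abs_le_iff) linarith+
    qed
    moreover have "v = vec n (restrict (($) v) {..<n})"
      using v by (intro eq_vecI) auto
    ultimately show "v \<in> vec n ` ({..<n} \<rightarrow>\<^sub>E {- \<lceil>c\<rceil>..\<lceil>c\<rceil>})"
      by (intro image_eqI[of _ _ "restrict (($) v) {..<n}"]) auto
  qed
  then show ?thesis by (rule finite_subset) (intro finite_imageI finite_PiE, auto)
qed

section \<open>The semidirect product\<close>

locale Zn_automorphism =
  fixes n :: nat and \<phi> :: "int vec \<Rightarrow> int vec"
  assumes \<phi>: "\<phi> \<in> auto (Zn n)"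
begin

abbreviation P :: "(int vec \<times> int) monoid"
  where "P \<equiv> Zn_semidirect_Z n \<phi>"

definition act :: "int \<Rightarrow> int vec \<Rightarrow> int vec"
  where "act k = \<phi> [^]\<^bsub>AutoGroup (Zn n)\<^esub> k"

sublocale P: group P
  by (rule group_Zn_semidirect_Z[OF \<phi>])

sublocale Aut: group "AutoGroup (Zn n)"
  by (rule group.AutoGroup[OF group_Zn])

lemma \<phi>_Aut: "\<phi> \<in> carrier (AutoGroup (Zn n))"
  using \<phi> by (simp add: AutoGroup_def)

lemma carrier_P: "x \<in> carrier P \<longleftrightarrow> fst x \<in> carrier_vec n"
  by (cases x) (simp add: Zn_semidirect_Z_def semidirect_def monoid_vec_def)

lemma one_P: "\<one>\<^bsub>P\<^esub> = (0\<^sub>v n, 0)"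
  by (simp add: Zn_semidirect_Z_def semidirect_def monoid_vec_def)

lemma mult_P: "(a, k) \<otimes>\<^bsub>P\<^esub> (b, l) = (a + act k b, k + l)"
  by (simp add: Zn_semidirect_Z_def semidirect_def monoid_vec_def act_def)

lemma snd_mult_P: "snd (x \<otimes>\<^bsub>P\<^esub> y) = snd x + snd y"
  by (cases x; cases y) (simp add: mult_P)

lemma act_auto: "act k \<in> auto (Zn n)"
  using Aut.int_pow_closed[OF \<phi>_Aut, of k] unfolding act_def by (simp add: AutoGroup_def)

lemma act_closed: "v \<in> carrier_vec n \<Longrightarrow> act k v \<in> carrier_vec n"
  using act_auto[of k] by (auto simp: auto_def hom_def monoid_vec_def)

lemma act_0: "v \<in> carrier_vec n \<Longrightarrow> act 0 v = v"
  by (simp add: act_def AutoGroup_def BijGroup_def monoid_vec_def)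

lemma act_1: "act 1 = \<phi>"
  by (simp add: act_def Aut.int_pow_1[OF \<phi>_Aut])

lemma act_add: "v \<in> carrier_vec n \<Longrightarrow> act (k + l) v = act k (act l v)"
proof -
  assume v: "v \<in> carrier_vec n"
  have "act (k + l) = act k \<otimes>\<^bsub>AutoGroup (Zn n)\<^esub> act l"
    unfolding act_def by (rule Aut.int_pow_mult[OF \<phi>_Aut])
  then show ?thesis
    using v act_auto[of k] act_auto[of l]
    by (auto simp: AutoGroup_def BijGroup_def auto_def compose_def monoid_vec_def)
qed

lemma snd_inv_P: "x \<in> carrier P \<Longrightarrow> snd (inv\<^bsub>P\<^esub> x) = - snd x"
  using snd_mult_P[of "inv\<^bsub>P\<^esub> x" x] by (simp add: one_P)

lemma inv_P_vec: "v \<in> carrier_vec n \<Longrightarrow> inv\<^bsub>P\<^esub> (v, 0) = (- v, 0)"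
  by (rule P.inv_equality) (auto simp: carrier_P one_P mult_P act_0)

lemma snd_pow_P: "x \<in> carrier P \<Longrightarrow> snd (x [^]\<^bsub>P\<^esub> (s :: int)) = s * snd x"
proof (induction s rule: int_induct[where k = 0])
  case base
  then show ?case by (simp add: one_P)
next
  case (step1 i)
  then show ?case by (simp add: P.int_pow_mult P.int_pow_1 snd_mult_P algebra_simps)
next
  case (step2 i)
  have "x [^]\<^bsub>P\<^esub> (i - 1) = x [^]\<^bsub>P\<^esub> i \<otimes>\<^bsub>P\<^esub> inv\<^bsub>P\<^esub> x"
    using P.int_pow_diff[of x i 1] step2 by simp
  then show ?case using step2 by (simp add: snd_mult_P snd_inv_P algebra_simps)
qed

lemma conjugate_vec:
  assumes "x \<in> carrier P" "v \<in> carrier_vec n"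
  shows "x \<otimes>\<^bsub>P\<^esub> (v, 0) \<otimes>\<^bsub>P\<^esub> inv\<^bsub>P\<^esub> x = (act (snd x) v, 0)"
proof -
  obtain a k where x: "x = (a, k)" "a \<in> carrier_vec n"
    using assms by (cases x) (auto simp: carrier_P)
  have "x \<otimes>\<^bsub>P\<^esub> (v, 0) = (act k v, 0) \<otimes>\<^bsub>P\<^esub> x"
    using x assms act_closed[of v k] by (simp add: mult_P act_0 comm_add_vec[of _ n])
  then show ?thesis
    using assms x act_closed[of v k] P.inv_solve_right'[of "(act k v, 0)" "x \<otimes>\<^bsub>P\<^esub> (v, 0)" x]
    by (simp add: carrier_P mult_P act_0)
qed

text \<open>
  The image of \<open>H\<close> in \<open>\<int>\<close> is cyclic, and \<open>g\<close> is a lift of a generator. The convention \<open>g = \<one>\<close> for a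
  trivial image lets the cases \<open>H \<subseteq> \<int>\<^sup>n\<close> and \<open>\<not> H \<subseteq> \<int>\<^sup>n\<close> be treated together.
\<close>

lemma subgroup_generator_over_vec:
  assumes H: "subgroup H P"
  obtains g where "g \<in> H" "snd g = 0 \<Longrightarrow> g = \<one>\<^bsub>P\<^esub>"
    "\<And>h. h \<in> H \<Longrightarrow> \<exists>s :: int. snd (h \<otimes>\<^bsub>P\<^esub> inv\<^bsub>P\<^esub> (g [^]\<^bsub>P\<^esub> s)) = 0"
proof (cases "\<exists>h\<in>H. snd h \<noteq> 0")
  case False
  show thesis
  proof (rule that)
    show "\<one>\<^bsub>P\<^esub> \<in> H" by (rule subgroup.one_closed[OF H])
    fix h assume "h \<in> H"
    then show "\<exists>s :: int. snd (h \<otimes>\<^bsub>P\<^esub> inv\<^bsub>P\<^esub> (\<one>\<^bsub>P\<^esub> [^]\<^bsub>P\<^esub> s)) = 0"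
      using False by (auto simp: snd_mult_P P.int_pow_one one_P[symmetric]) (simp add: one_P)
  qed auto
next
  case True
  note HP = subgroup.mem_carrier[OF H]
  define Q where "Q k \<longleftrightarrow> k > 0 \<and> (\<exists>h\<in>H. snd h = int k)" for k
  have "\<exists>k. Q k"
  proof -
    obtain h where h: "h \<in> H" "snd h \<noteq> 0" using True by auto
    show ?thesis
    proof (cases "snd h > 0")
      case True
      then show ?thesis using h by (intro exI[of _ "nat (snd h)"]) (auto simp: Q_def)
    next
      case False
      then have "Q (nat (- snd h))"
        using h subgroup.m_inv_closed[OF H h(1)] snd_inv_P[OF HP[OF h(1)]]
        by (auto simp: Q_def intro!: bexI[of _ "inv\<^bsub>P\<^esub> h"])
      then show ?thesis by blast
    qed
  qed
  then have "Q (LEAST k. Q k)" by (rule LeastI_ex)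
  then obtain g where g: "g \<in> H" "snd g = int (LEAST k. Q k)" "snd g > 0"
    by (auto simp: Q_def)
  show thesis
  proof (rule that[OF g(1)])
    fix h assume h: "h \<in> H"
    define s where "s = snd h div snd g"
    let ?r = "h \<otimes>\<^bsub>P\<^esub> inv\<^bsub>P\<^esub> (g [^]\<^bsub>P\<^esub> s)"
    have "g [^]\<^bsub>P\<^esub> s \<in> H"
      using P.subgroup_int_pow_closed[OF H g(1)] .
    then have r: "?r \<in> H" "snd ?r = snd h mod snd g"
      using h HP[OF g(1)] H
      by (auto simp: snd_mult_P snd_inv_P snd_pow_P s_def minus_div_mult_eq_mod
          subgroup.m_closed subgroup.m_inv_closed)
    have "snd ?r = 0"
    proof (rule ccontr)
      assume "snd ?r \<noteq> 0"
      then have "Q (nat (snd ?r))"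
        using r g(3) by (auto simp: Q_def intro!: bexI[OF _ r(1)] order.not_eq_order_implies_strict)
      then have "(LEAST k. Q k) \<le> nat (snd ?r)" by (rule Least_le)
      moreover have "snd ?r < snd g" using r g(3) by simp
      ultimately show False using g(2,3) by linarith
    qed
    then show "\<exists>s :: int. snd (h \<otimes>\<^bsub>P\<^esub> inv\<^bsub>P\<^esub> (g [^]\<^bsub>P\<^esub> s)) = 0" by blast
  qed (use g in auto)
qed

text \<open>
  The part of \<open>H B H\<close> inside \<open>\<int>\<^sup>n\<close> consists, modulo \<open>K = H \<inter> \<int>\<^sup>n\<close>, of the orbits of a finite set
  under \<open>\<phi>\<^sup>m\<close>. Writing \<open>h = x g\<^sup>s\<close> and \<open>h' = y g\<^bsup>s'\<^esup>\<close> with \<open>x, y \<in> K\<close>, the product \<open>h b h'\<inverse>\<close> is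
  \<open>x g\<^sup>s b g\<^bsup>-s'\<^esup> y\<inverse>\<close>. If it lies in \<open>\<int>\<^sup>n\<close>, then \<open>u = s - s'\<close> is determined by \<open>b\<close>, and
  \<open>g\<^sup>s b g\<^bsup>-s'\<^esup>\<close> is the conjugate by \<open>g\<^sup>s\<close> of the vector \<open>b g\<^sup>u\<close>, that is, its image under \<open>\<phi>\<^bsup>ms\<^esup>\<close>.
\<close>

lemma double_coset_vec:
  assumes H: "subgroup H P" and B: "finite B" "B \<subseteq> carrier P"
  obtains F m where "finite F" "F \<subseteq> carrier_vec n"
    "\<And>v s. (v, 0) \<in> H \<Longrightarrow> (act (m * s) v, 0) \<in> H"
    "\<And>h b h' v. h \<in> H \<Longrightarrow> b \<in> B \<Longrightarrow> h' \<in> H \<Longrightarrow> h \<otimes>\<^bsub>P\<^esub> b \<otimes>\<^bsub>P\<^esub> inv\<^bsub>P\<^esub> h' = (v, 0) \<Longrightarrow>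
      \<exists>s. \<exists>f\<in>F. \<exists>x y. (x, 0) \<in> H \<and> (y, 0) \<in> H \<and> v + y = x + act (m * s) f"
proof -
  note HP = subgroup.mem_carrier[OF H]
  obtain g where g: "g \<in> H" "snd g = 0 \<Longrightarrow> g = \<one>\<^bsub>P\<^esub>"
    "\<And>h. h \<in> H \<Longrightarrow> \<exists>s :: int. snd (h \<otimes>\<^bsub>P\<^esub> inv\<^bsub>P\<^esub> (g [^]\<^bsub>P\<^esub> s)) = 0"
    using subgroup_generator_over_vec[OF H] by blast
  have gP: "g \<in> carrier P" by (rule HP[OF g(1)])
  have powH: "g [^]\<^bsub>P\<^esub> s \<in> H" for s :: int
    using P.subgroup_int_pow_closed[OF H g(1)] .
  define m where "m = snd g"
  \<comment> \<open>for \<open>m = 0\<close> the exponent is \<open>0\<close>, as division by zero yields zero; this is harmless since then \<open>g = \<one>\<close>\<close>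
  define F where "F = (\<lambda>b. fst (b \<otimes>\<^bsub>P\<^esub> g [^]\<^bsub>P\<^esub> (- snd b div m))) ` B"
  show thesis
  proof (rule that[of F m])
    show "finite F" unfolding F_def using B by simp
    show "F \<subseteq> carrier_vec n"
      unfolding F_def using B gP carrier_P by blast
  next
    fix v and s :: int assume v: "(v, 0) \<in> H"
    have "g [^]\<^bsub>P\<^esub> s \<otimes>\<^bsub>P\<^esub> (v, 0) \<otimes>\<^bsub>P\<^esub> inv\<^bsub>P\<^esub> (g [^]\<^bsub>P\<^esub> s) \<in> H"
      using H v powH by (simp add: subgroup.m_closed subgroup.m_inv_closed)
    then show "(act (m * s) v, 0) \<in> H"
      using conjugate_vec[of "g [^]\<^bsub>P\<^esub> s" v] HP[OF v] P.int_pow_closed[OF gP, of s] gP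
      by (simp add: carrier_P[of "(v, 0)"] snd_pow_P m_def mult.commute)
  next
    fix h b h' v
    assume h: "h \<in> H" and b: "b \<in> B" and h': "h' \<in> H"
      and prod: "h \<otimes>\<^bsub>P\<^esub> b \<otimes>\<^bsub>P\<^esub> inv\<^bsub>P\<^esub> h' = (v, 0)"
    have bP: "b \<in> carrier P" using b B by auto
    obtain s where s: "snd (h \<otimes>\<^bsub>P\<^esub> inv\<^bsub>P\<^esub> (g [^]\<^bsub>P\<^esub> (s::int))) = 0" using g(3)[OF h] by blast
    obtain s' where s': "snd (h' \<otimes>\<^bsub>P\<^esub> inv\<^bsub>P\<^esub> (g [^]\<^bsub>P\<^esub> (s'::int))) = 0" using g(3)[OF h'] by blast
    define x y where "x = fst (h \<otimes>\<^bsub>P\<^esub> inv\<^bsub>P\<^esub> (g [^]\<^bsub>P\<^esub> s))" and "y = fst (h' \<otimes>\<^bsub>P\<^esub> inv\<^bsub>P\<^esub> (g [^]\<^bsub>P\<^esub> s'))"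
    have x: "h \<otimes>\<^bsub>P\<^esub> inv\<^bsub>P\<^esub> (g [^]\<^bsub>P\<^esub> s) = (x, 0)" and y: "h' \<otimes>\<^bsub>P\<^esub> inv\<^bsub>P\<^esub> (g [^]\<^bsub>P\<^esub> s') = (y, 0)"
      using s s' by (simp_all add: x_def y_def prod_eq_iff)
    have xH: "(x, 0) \<in> H" and yH: "(y, 0) \<in> H"
      unfolding x[symmetric] y[symmetric]
      using H h h' powH by (simp_all add: subgroup.m_closed subgroup.m_inv_closed)
    define u where "u = - snd b div m"
    have hx: "h = (x, 0) \<otimes>\<^bsub>P\<^esub> g [^]\<^bsub>P\<^esub> s"
      using x[symmetric] HP[OF h] gP by (simp add: P.m_assoc)
    have hy: "h' = (y, 0) \<otimes>\<^bsub>P\<^esub> g [^]\<^bsub>P\<^esub> s'"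
      using y[symmetric] HP[OF h'] gP by (simp add: P.m_assoc)
    have exponents: "snd b = m * (s' - s)"
      using arg_cong[OF prod, of snd] HP[OF h] HP[OF h'] hx hy gP
      by (simp add: snd_mult_P snd_inv_P snd_pow_P m_def algebra_simps)
    have pow: "g [^]\<^bsub>P\<^esub> (- s') = g [^]\<^bsub>P\<^esub> u \<otimes>\<^bsub>P\<^esub> g [^]\<^bsub>P\<^esub> (- s)"
    proof (cases "m = 0")
      case True
      then show ?thesis using g(2) by (simp add: m_def)
    next
      case False
      have "- (m * (s' - s)) = m * (s - s')" by (simp add: algebra_simps)
      then have "u = s - s'" unfolding u_def exponents using False by simp
      then show ?thesis using gP by (simp add: P.int_pow_mult[symmetric])
    qed
    define f where "f = fst (b \<otimes>\<^bsub>P\<^esub> g [^]\<^bsub>P\<^esub> u)"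
    have fF: "f \<in> F" unfolding f_def u_def F_def using b by blast
    have "snd (b \<otimes>\<^bsub>P\<^esub> g [^]\<^bsub>P\<^esub> u) = 0"
      using gP exponents by (cases "m = 0") (auto simp: snd_mult_P snd_pow_P m_def[symmetric] u_def one_P)
    then have f: "b \<otimes>\<^bsub>P\<^esub> g [^]\<^bsub>P\<^esub> u = (f, 0)" by (simp add: f_def prod_eq_iff)
    have cl: "x \<in> carrier_vec n" "y \<in> carrier_vec n" "f \<in> carrier_vec n" "v \<in> carrier_vec n"
      using HP[OF xH] HP[OF yH] f bP gP prod HP[OF h] HP[OF h']
        P.m_closed[OF bP P.int_pow_closed[OF gP, of u]]
        P.m_closed[OF P.m_closed[OF HP[OF h] bP] P.inv_closed[OF HP[OF h']]]
      by (auto simp: carrier_P)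
    have "(v, 0) \<otimes>\<^bsub>P\<^esub> (y, 0) = h \<otimes>\<^bsub>P\<^esub> b \<otimes>\<^bsub>P\<^esub> (inv\<^bsub>P\<^esub> h' \<otimes>\<^bsub>P\<^esub> (y, 0))"
      using prod[symmetric] HP[OF h] HP[OF h'] bP HP[OF yH] by (simp add: P.m_assoc)
    also have "inv\<^bsub>P\<^esub> h' \<otimes>\<^bsub>P\<^esub> (y, 0) = g [^]\<^bsub>P\<^esub> (- s')"
      using gP HP[OF yH] by (simp add: hy P.inv_mult_group P.m_assoc P.int_pow_neg)
    also have "h \<otimes>\<^bsub>P\<^esub> b \<otimes>\<^bsub>P\<^esub> g [^]\<^bsub>P\<^esub> (- s') =
        (x, 0) \<otimes>\<^bsub>P\<^esub> (g [^]\<^bsub>P\<^esub> s \<otimes>\<^bsub>P\<^esub> (b \<otimes>\<^bsub>P\<^esub> g [^]\<^bsub>P\<^esub> u) \<otimes>\<^bsub>P\<^esub> inv\<^bsub>P\<^esub> (g [^]\<^bsub>P\<^esub> s))"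
      using gP bP HP[OF xH] by (simp add: hx pow P.m_assoc P.int_pow_neg)
    also have "\<dots> = (x, 0) \<otimes>\<^bsub>P\<^esub> (act (m * s) f, 0)"
      using conjugate_vec[of "g [^]\<^bsub>P\<^esub> s" f] gP cl by (simp add: f snd_pow_P m_def mult.commute)
    finally have "v + y = x + act (m * s) f"
      using cl act_closed by (simp add: mult_P act_0)
    then show "\<exists>s. \<exists>f\<in>F. \<exists>x y. (x, 0) \<in> H \<and> (y, 0) \<in> H \<and> v + y = x + act (m * s) f"
      using xH yH fF by blast
  qed
qed

lemma finite_generating_set_P:
  "finite_generating_set P (insert (0\<^sub>v n, 1) ((\<lambda>j. (unit_vec n j, 0)) ` {..<n}))"
  (is "finite_generating_set P ?S")
proof -
  have S: "?S \<subseteq> carrier P" by (auto simp: carrier_P)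
  have sub: "subgroup (generate P ?S) P" by (rule P.generate_is_subgroup[OF S])
  note [simp] = subgroup.m_closed[OF sub]
  have pow: "g [^]\<^bsub>P\<^esub> k \<in> generate P ?S" if "g \<in> generate P ?S" for g and k :: int
    using P.subgroup_int_pow_closed[OF sub that] .
  have multiple: "(v, 0) [^]\<^bsub>P\<^esub> k = (k \<cdot>\<^sub>v v, 0)" if v: "v \<in> carrier_vec n" for v and k :: int
  proof (induction k rule: int_induct[where k = 0])
    case base
    then show ?case using v by (auto simp: one_P)
  next
    case (step1 i)
    have "(v, 0) [^]\<^bsub>P\<^esub> (i + 1) = (v, 0) [^]\<^bsub>P\<^esub> i \<otimes>\<^bsub>P\<^esub> (v, 0)"
      using v by (simp add: P.int_pow_mult P.int_pow_1 carrier_P)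
    also have "\<dots> = ((i + 1) \<cdot>\<^sub>v v, 0)"
      using v step1 by (simp add: mult_P act_0 add_smult_distrib_vec)
    finally show ?case .
  next
    case (step2 i)
    have "(v, 0) [^]\<^bsub>P\<^esub> (i - 1) = (v, 0) [^]\<^bsub>P\<^esub> i \<otimes>\<^bsub>P\<^esub> inv\<^bsub>P\<^esub> (v, 0)"
      using v P.int_pow_diff[of "(v, 0)" i 1] by (simp add: P.int_pow_1 carrier_P)
    also have "\<dots> = ((i - 1) \<cdot>\<^sub>v v, 0)"
      using v step2 by (simp add: mult_P act_0 inv_P_vec) (auto simp: algebra_simps)
    finally show ?case .
  qed
  have vec: "(v, 0) \<in> generate P ?S" if v: "v \<in> carrier_vec n" for v
  proof -
    define w where "w m = vec n (\<lambda>i. if i < m then v $ i else 0)" for m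
    have "(w m, 0) \<in> generate P ?S" if "m \<le> n" for m
      using that
    proof (induction m)
      case 0
      have "w 0 = 0\<^sub>v n" by (intro eq_vecI) (auto simp: w_def)
      then show ?case using generate.one[of P ?S] by (simp add: one_P)
    next
      case (Suc m)
      have "w (Suc m) = w m + v $ m \<cdot>\<^sub>v unit_vec n m"
        using Suc.prems by (intro eq_vecI) (auto simp: w_def unit_vec_def less_Suc_eq)
      then have "(w (Suc m), 0) = (w m, 0) \<otimes>\<^bsub>P\<^esub> (unit_vec n m, 0) [^]\<^bsub>P\<^esub> (v $ m)"
        by (simp add: multiple mult_P act_0)
      moreover have "(unit_vec n m, 0) \<in> generate P ?S"
        using Suc.prems by (intro generate.incl) auto
      ultimately show ?case using Suc pow by simp
    qed
    moreover have "w n = v" using v by (intro eq_vecI) (auto simp: w_def)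
    ultimately show ?thesis by force
  qed
  have "(v, k) \<in> generate P ?S" if v: "v \<in> carrier_vec n" for v k
  proof -
    define t where "t = ((0\<^sub>v n, 1) :: int vec \<times> int) [^]\<^bsub>P\<^esub> k"
    have t: "t \<in> generate P ?S"
      unfolding t_def by (intro pow generate.incl) auto
    then have tP: "t \<in> carrier P" using subgroup.mem_carrier[OF sub] by blast
    have "snd t = k" unfolding t_def by (simp add: snd_pow_P carrier_P)
    then have "(v, k) = (v - fst t, 0) \<otimes>\<^bsub>P\<^esub> t"
      using tP v by (cases t) (auto simp: mult_P act_0 carrier_P)
    then show ?thesis using t vec[of "v - fst t"] v tP by (simp add: carrier_P)
  qed
  then have "carrier P \<subseteq> generate P ?S" by (auto simp: carrier_P)
  then show ?thesis
    using S P.generate_incl[OF S] unfolding finite_generating_set_def by auto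
qed

section \<open>Eigencoordinates\<close>

text \<open>
  With \<open>A = B D C\<close> and \<open>C = B\<inverse>\<close>, the rows of \<open>C\<close> are eigenfunctionals. Integer vectors with bounded
  coordinates are bounded, because \<open>B\<close> recovers a vector from its coordinates. Nonvanishing of the
  eigenvalues needs no determinant: if \<open>D\<close> had the diagonal entry \<open>0\<close>, then the corresponding
  functional would vanish on the image of \<open>\<phi>\<close>, which is everything, so that the eigenvalue may be
  declared to be \<open>1\<close>.
\<close>

lemma eigen_coordinates:
  assumes "diagonalizable_over_reals n \<phi>"
  obtains L :: "int vec \<Rightarrow> nat \<Rightarrow> real" and \<mu> :: "nat \<Rightarrow> real"
  where "\<And>v w. v \<in> carrier_vec n \<Longrightarrow> w \<in> carrier_vec n \<Longrightarrow> L (v + w) = L v + L w"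
    and "\<And>v i. v \<in> carrier_vec n \<Longrightarrow> L (\<phi> v) i = \<mu> i * L v i"
    and "\<And>i. \<mu> i \<noteq> 0"
    and "\<And>v i. n \<le> i \<Longrightarrow> L v i = 0"
    and "\<And>R. finite {v \<in> carrier_vec n. \<forall>i<n. \<bar>L v i\<bar> \<le> R}"
    and "inj_on L (carrier_vec n)"
proof -
  define A where "A = map_mat real_of_int (end_matrix n \<phi>)"
  have A: "A \<in> carrier_mat n n" by (simp add: A_def end_matrix_def)
  obtain D where D: "diagonal_mat D" "similar_mat A D"
    using assms by (auto simp: diagonalizable_over_reals_def diagonalizable_def A_def)
  obtain B C where sim: "similar_mat_wit A D B C" using D(2) by (auto simp: similar_mat_def)
  have dims: "D \<in> carrier_mat n n" "B \<in> carrier_mat n n" "C \<in> carrier_mat n n"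
    and inv: "B * C = 1\<^sub>m n" "C * B = 1\<^sub>m n" and A_eq: "A = B * D * C"
    using similar_mat_witD2[OF A sim] by auto
  have CA: "C * A = D * C"
  proof -
    have "C * A = (C * B) * (D * C)"
      unfolding A_eq using dims by (simp add: assoc_mult_mat[of _ n n _ n _ n])
    then show ?thesis using inv dims by simp
  qed
  define r where "r v = map_vec real_of_int v" for v
  have r: "r v \<in> carrier_vec n" if "v \<in> carrier_vec n" for v using that by (simp add: r_def)
  have r_\<phi>: "r (\<phi> v) = A *\<^sub>v r v" if v: "v \<in> carrier_vec n" for v
    unfolding auto_eq_mult_end_matrix[OF \<phi> v] r_def A_def
    using v by (intro of_int_hom.mult_mat_vec_hom) (auto simp: end_matrix_def)
  define L where "L v = (\<lambda>i. if i < n then (C *\<^sub>v r v) $ i else 0)" for v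
  define \<mu> where "\<mu> = (\<lambda>i. if i < n \<and> D $$ (i, i) \<noteq> 0 then D $$ (i, i) else 1)"
  have \<phi>_closed: "\<phi> v \<in> carrier_vec n" if "v \<in> carrier_vec n" for v
    using act_closed[of v 1] that by (simp add: act_1)
  have eigen: "L (\<phi> v) i = D $$ (i, i) * L v i" if v: "v \<in> carrier_vec n" and i: "i < n" for v i
  proof -
    have "C *\<^sub>v r (\<phi> v) = D *\<^sub>v (C *\<^sub>v r v)"
      using assoc_mult_mat_vec[OF dims(3) A r[OF v]] assoc_mult_mat_vec[OF dims(1,3) r[OF v]]
      by (simp add: r_\<phi>[OF v] CA)
    then have "L (\<phi> v) i = (D *\<^sub>v (C *\<^sub>v r v)) $ i" using i by (simp add: L_def)
    also have "\<dots> = (\<Sum>j<n. D $$ (i, j) * (C *\<^sub>v r v) $ j)"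
      using dims i r[OF v] by (simp add: scalar_prod_def atLeast0LessThan)
    also have "\<dots> = (\<Sum>j<n. if j = i then D $$ (i, i) * (C *\<^sub>v r v) $ i else 0)"
      using D(1) dims i by (intro sum.cong) (auto simp: diagonal_mat_def)
    finally show ?thesis using i by (simp add: L_def)
  qed
  have recover: "\<bar>real_of_int (v $ j)\<bar> \<le> (\<Sum>i<n. \<Sum>k<n. \<bar>B $$ (i, k)\<bar>) * R"
    if v: "v \<in> carrier_vec n" and j: "j < n" and R: "\<forall>i<n. \<bar>L v i\<bar> \<le> R" for v j R
  proof -
    have "R \<ge> 0" using R j abs_ge_zero order_trans by blast
    have "r v = B *\<^sub>v (C *\<^sub>v r v)"
      using assoc_mult_mat_vec[OF dims(2,3) r[OF v]] r[OF v] inv by simp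
    then have "real_of_int (v $ j) = (B *\<^sub>v (C *\<^sub>v r v)) $ j"
      using v j by (metis r_def carrier_vecD index_map_vec(1))
    also have "\<dots> = (\<Sum>k<n. B $$ (j, k) * L v k)"
      using dims j r[OF v] by (simp add: scalar_prod_def atLeast0LessThan L_def)
    finally have "\<bar>real_of_int (v $ j)\<bar> \<le> (\<Sum>k<n. \<bar>B $$ (j, k) * L v k\<bar>)"
      by simp
    also have "\<dots> \<le> (\<Sum>k<n. \<bar>B $$ (j, k)\<bar> * R)"
      using R by (intro sum_mono) (auto simp: abs_mult intro: mult_left_mono)
    also have "\<dots> = (\<Sum>k<n. \<bar>B $$ (j, k)\<bar>) * R" by (simp add: sum_distrib_right)
    also have "\<dots> \<le> (\<Sum>i<n. \<Sum>k<n. \<bar>B $$ (i, k)\<bar>) * R"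
      by (intro mult_right_mono member_le_sum[of j "{..<n}" "\<lambda>i. \<Sum>k<n. \<bar>B $$ (i, k)\<bar>"])
        (use j \<open>R \<ge> 0\<close> in \<open>auto intro: sum_nonneg\<close>)
    finally show ?thesis .
  qed
  show thesis
  proof (rule that[of L \<mu>])
    show "L (v + w) = L v + L w" if "v \<in> carrier_vec n" "w \<in> carrier_vec n" for v w
    proof -
      have "r (v + w) = r v + r w" using that by (intro eq_vecI) (auto simp: r_def)
      then show ?thesis
        using that dims r by (auto simp: L_def fun_eq_iff mult_add_distrib_mat_vec[of _ n n])
    qed
    show "L (\<phi> v) i = \<mu> i * L v i" if v: "v \<in> carrier_vec n" for v i
    proof (cases "i < n \<and> D $$ (i, i) = 0")
      case True
      have "L w i = 0" if w: "w \<in> carrier_vec n" for w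
      proof -
        have "w = \<phi> (act (- 1) w)"
          using act_add[OF w, of 1 "- 1"] act_0[OF w] by (simp add: act_1)
        then show ?thesis using eigen[of "act (- 1) w" i] act_closed[OF w] True by simp
      qed
      then show ?thesis using v \<phi>_closed by simp
    next
      case False
      then show ?thesis using eigen[OF v, of i] by (cases "i < n") (simp_all add: \<mu>_def L_def)
    qed
    show "\<mu> i \<noteq> 0" for i by (simp add: \<mu>_def)
    show "L v i = 0" if "n \<le> i" for v i using that by (simp add: L_def)
    show "finite {v \<in> carrier_vec n. \<forall>i<n. \<bar>L v i\<bar> \<le> R}" for R
      by (rule finite_subset[OF _ finite_bounded_int_vecs]) (use recover in blast)
    show "inj_on L (carrier_vec n)"
    proof (rule inj_onI)
      fix v w assume vw: "v \<in> carrier_vec n" "w \<in> carrier_vec n" "L v = L w"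
      have "C *\<^sub>v r v = C *\<^sub>v r w"
      proof (rule eq_vecI)
        fix i assume "i < dim_vec (C *\<^sub>v r w)"
        then show "(C *\<^sub>v r v) $ i = (C *\<^sub>v r w) $ i"
          using fun_cong[OF vw(3), of i] dims by (simp add: L_def)
      qed (use dims in auto)
      then have "B *\<^sub>v (C *\<^sub>v r v) = B *\<^sub>v (C *\<^sub>v r w)" by simp
      then have "r v = r w"
        using assoc_mult_mat_vec[OF dims(2,3) r[OF vw(1)]] assoc_mult_mat_vec[OF dims(2,3) r[OF vw(2)]]
          r[OF vw(1)] r[OF vw(2)] inv by simp
      then have "real_of_int (v $ i) = real_of_int (w $ i)" if "i < n" for i
        using that vw by (metis r_def carrier_vecD index_map_vec(1))
      then show "v = w" using vw by (intro eq_vecI) auto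
    qed
  qed
qed

section \<open>Families of close cosets\<close>


text \<open>
  Every coset in a \<open>B\<close>-close family has a representative whose \<open>\<int>\<close>-part is in a set of at most
  \<open>card B + 1\<close> values, so one may fix that value. Then the quotient of two representatives is a vector;
  it does not lie in \<open>K = H \<inter> \<int>\<^sup>n\<close> as the cosets differ, and it lies in \<open>H B H\<close> as they are close. In
  eigencoordinates this is the situation of \<open>clique_bound\<close>.
\<close>

lemma close_cosets_bounded:
  assumes diag: "diagonalizable_over_reals n \<phi>" and H: "subgroup H P"
    and B: "finite B" "B \<subseteq> carrier P"
  shows "\<exists>M. \<forall>C. finite C \<and> C \<subseteq> lcosets\<^bsub>P\<^esub> H \<and>
      (\<forall>X\<in>C. \<forall>Y\<in>C. X \<noteq> Y \<longrightarrow> (\<exists>x\<in>X. \<exists>y\<in>Y. inv\<^bsub>P\<^esub> x \<otimes>\<^bsub>P\<^esub> y \<in> B)) \<longrightarrow> card C \<le> M"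
proof -
  note HP = subgroup.mem_carrier[OF H]
  obtain L :: "int vec \<Rightarrow> nat \<Rightarrow> real" and \<mu> :: "nat \<Rightarrow> real"
    where L_add: "\<And>v w. v \<in> carrier_vec n \<Longrightarrow> w \<in> carrier_vec n \<Longrightarrow> L (v + w) = L v + L w"
      and L_\<phi>: "\<And>v i. v \<in> carrier_vec n \<Longrightarrow> L (\<phi> v) i = \<mu> i * L v i"
      and \<mu>: "\<And>i. \<mu> i \<noteq> 0"
      and L_support: "\<And>v i. n \<le> i \<Longrightarrow> L v i = 0"
      and L_discrete: "\<And>R. finite {v \<in> carrier_vec n. \<forall>i<n. \<bar>L v i\<bar> \<le> R}"
      and L_inj: "inj_on L (carrier_vec n)"
    using eigen_coordinates[OF diag] by blast
  have L_act: "L (act k v) = (\<lambda>i. \<mu> i powi k * L v i)" if v: "v \<in> carrier_vec n" for k v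
  proof (induction k rule: int_induct[where k = 0])
    case base
    then show ?case by (simp add: act_0[OF v])
  next
    case (step1 k)
    have "act (k + 1) v = \<phi> (act k v)"
      using act_add[OF v, of 1 k] by (simp add: act_1 add.commute)
    then show ?case
      using step1 L_\<phi>[OF act_closed[OF v]] \<mu> by (auto simp: power_int_add_1' fun_eq_iff)
  next
    case (step2 k)
    have "act k v = \<phi> (act (k - 1) v)"
      using act_add[OF v, of 1 "k - 1"] by (simp add: act_1)
    then have "\<mu> i powi k * L v i = \<mu> i * L (act (k - 1) v) i" for i
      using step2 L_\<phi>[OF act_closed[OF v], of "k - 1" i] by (metis (no_types))
    then have "L (act (k - 1) v) i = \<mu> i powi k / \<mu> i * L v i" for i
      using \<mu>[of i] by (simp add: field_simps)
    then show ?case using \<mu> by (simp add: power_int_diff fun_eq_iff)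
  qed
  have L_zero: "L (0\<^sub>v n) = 0" using L_add[of "0\<^sub>v n" "0\<^sub>v n"] by simp
  have L_diff: "L (v - w) = L v - L w" if "v \<in> carrier_vec n" "w \<in> carrier_vec n" for v w
  proof -
    have "v - w + w = v" using that by auto
    then have "L v = L (v - w) + L w" using L_add[of "v - w" w] that by simp
    then show ?thesis by (simp only: add_diff_cancel_right')
  qed
  obtain F m where F: "finite F" "F \<subseteq> carrier_vec n"
    and H_inv: "\<And>v s. (v, 0) \<in> H \<Longrightarrow> (act (m * s) v, 0) \<in> H"
    and HBH: "\<And>h b h' v. h \<in> H \<Longrightarrow> b \<in> B \<Longrightarrow> h' \<in> H \<Longrightarrow> h \<otimes>\<^bsub>P\<^esub> b \<otimes>\<^bsub>P\<^esub> inv\<^bsub>P\<^esub> h' = (v, 0) \<Longrightarrow>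
      \<exists>s. \<exists>f\<in>F. \<exists>x y. (x, 0) \<in> H \<and> (y, 0) \<in> H \<and> v + y = x + act (m * s) f"
    by (rule double_coset_vec[OF H B]) (rule that)
  define K where "K = {v. (v, 0) \<in> H}"
  have K_vec: "v \<in> carrier_vec n" if "v \<in> K" for v
    using HP that by (force simp: K_def carrier_P)
  have K_diff: "v - w \<in> K" if "v \<in> K" "w \<in> K" for v w
  proof -
    have "(v, 0) \<otimes>\<^bsub>P\<^esub> inv\<^bsub>P\<^esub> (w, 0) \<in> H"
      using that H by (simp add: K_def subgroup.m_closed subgroup.m_inv_closed)
    then show ?thesis
      using K_vec[OF that(1)] K_vec[OF that(2)]
      by (simp add: K_def inv_P_vec mult_P act_0 minus_add_uminus_vec[symmetric])
  qed
  have K_zero: "0\<^sub>v n \<in> K" using subgroup.one_closed[OF H] by (simp add: K_def one_P)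
  have powi_mult: "(\<mu> i powi m) powi s = \<mu> i powi (m * s)" for i s
    by (simp add: power_int_mult)
  \<comment> \<open>the automorphism acting on the lattice is \<open>\<phi>\<^sup>m\<close>, since only its powers are conjugations by elements of \<open>H\<close>\<close>
  interpret diagonal_lattice n "\<lambda>i. \<mu> i powi m" "L ` carrier_vec n" "L ` K"
  proof
    show "\<mu> i powi m \<noteq> 0" for i using \<mu> by simp
    show "additive_subgroup (L ` carrier_vec n)"
      unfolding additive_subgroup_def
      by (auto simp: L_diff[symmetric] L_zero[symmetric] simp del: L_zero)
    show "additive_subgroup (L ` K)"
      unfolding additive_subgroup_def
      using K_zero K_diff K_vec by (auto simp: L_diff[symmetric] L_zero[symmetric])
    show "x i = 0" if "x \<in> L ` carrier_vec n" "n \<le> i" for x i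
      using that L_support by auto
    show "finite {x \<in> L ` carrier_vec n. \<forall>i<n. \<bar>x i\<bar> \<le> R}" for R
      by (rule finite_subset[OF _ finite_imageI[OF L_discrete[of R], of L]]) auto
    show "L ` K \<subseteq> L ` carrier_vec n" using K_vec by auto
    show "(\<lambda>i. (\<mu> i powi m) powi s * x i) \<in> L ` carrier_vec n" if x: "x \<in> L ` carrier_vec n" for x s
    proof -
      obtain v where v: "v \<in> carrier_vec n" "x = L v" using x by auto
      then show ?thesis
        using L_act[OF v(1), of "m * s"] act_closed[OF v(1), of "m * s"]
        by (auto simp: powi_mult intro!: image_eqI[of _ _ "act (m * s) v"])
    qed
    show "(\<lambda>i. (\<mu> i powi m) powi s * x i) \<in> L ` K" if x: "x \<in> L ` K" for x s
    proof -
      obtain v where v: "v \<in> K" "x = L v" using x by auto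
      then show ?thesis
        using L_act[OF K_vec[OF v(1)], of "m * s"] H_inv[of v s]
        by (auto simp: powi_mult K_def intro!: image_eqI[of _ _ "act (m * s) v"])
    qed
  qed
  have T_L: "T s (L v) = L (act (m * s) v)" if "v \<in> carrier_vec n" for s v
    by (simp add: T_def L_act[OF that] powi_mult)
  have LF: "finite (L ` F)" "L ` F \<subseteq> L ` carrier_vec n" using F by auto
  obtain M where M: "\<forall>A. finite A \<longrightarrow> (\<forall>x\<in>A. \<forall>y\<in>A. x \<noteq> y \<longrightarrow>
      x - y \<notin> L ` K \<and> (\<exists>s. \<exists>f\<in>L ` F. x - y - T s f \<in> L ` K)) \<longrightarrow> card A \<le> M"
    using clique_bound[OF LF] by (rule exE)
  have cosetD: "X \<subseteq> carrier P \<and> X \<noteq> {}" if "X \<in> lcosets\<^bsub>P\<^esub> H" for X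
    using that subgroup.subset[OF H] subgroup.one_closed[OF H]
    unfolding LCOSETS_def l_coset_def by blast
  have cosetE: "X = x <#\<^bsub>P\<^esub> H" if "X \<in> lcosets\<^bsub>P\<^esub> H" "x \<in> X" for X x
    using that P.l_repr_independence[OF _ _ H] unfolding LCOSETS_def by blast
  show ?thesis
  proof (intro exI[of _ "Suc (card B) * M"] allI impI)
    fix C
    assume "finite C \<and> C \<subseteq> lcosets\<^bsub>P\<^esub> H \<and>
      (\<forall>X\<in>C. \<forall>Y\<in>C. X \<noteq> Y \<longrightarrow> (\<exists>x\<in>X. \<exists>y\<in>Y. inv\<^bsub>P\<^esub> x \<otimes>\<^bsub>P\<^esub> y \<in> B))"
    then have C: "finite C" "C \<subseteq> lcosets\<^bsub>P\<^esub> H"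
      and close: "\<And>X Y. X \<in> C \<Longrightarrow> Y \<in> C \<Longrightarrow> X \<noteq> Y \<Longrightarrow> \<exists>x\<in>X. \<exists>y\<in>Y. inv\<^bsub>P\<^esub> x \<otimes>\<^bsub>P\<^esub> y \<in> B"
      by auto
    have rep: "\<exists>h\<in>H. y = x \<otimes>\<^bsub>P\<^esub> h" if "X \<in> C" "x \<in> X" "y \<in> X" for X x y
      using cosetE[of X x] C(2) that by (auto simp: l_coset_def)
    have translate: "x \<otimes>\<^bsub>P\<^esub> h \<in> X" if "X \<in> C" "x \<in> X" "h \<in> H" for X x h
      using cosetE[of X x] C(2) that by (auto simp: l_coset_def)
    have XP: "x \<in> carrier P" if "X \<in> C" "x \<in> X" for X x
      using cosetD C(2) that by blast
    show "card C \<le> Suc (card B) * M"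
    proof (cases "C = {}")
      case False
      then obtain X0 where X0: "X0 \<in> C" by auto
      then obtain x0 where x0: "x0 \<in> X0" using cosetD C(2) by blast
      \<comment> \<open>the \<open>\<int>\<close>-parts that suffice: every coset is close to \<open>X0\<close>, and translating by \<open>H\<close> moves the
        relevant point of \<open>X0\<close> back to \<open>x0\<close>\<close>
      define I where "I = insert (snd x0) ((\<lambda>b. snd x0 + snd b) ` B)"
      have I: "finite I" "card I \<le> Suc (card B)"
        unfolding I_def using B card_image_le[OF B(1), of "\<lambda>b. snd x0 + snd b"]
        by (auto intro: order_trans[OF card_insert_le_m1])
      have "\<exists>y\<in>Y. snd y \<in> I" if Y: "Y \<in> C" for Y
      proof (cases "Y = X0")
        case True
        then show ?thesis using x0 by (auto simp: I_def)
      next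
        case False
        then obtain x y where xy: "x \<in> X0" "y \<in> Y" "inv\<^bsub>P\<^esub> x \<otimes>\<^bsub>P\<^esub> y \<in> B"
          using close[OF X0 Y] by auto
        obtain h where h: "h \<in> H" "x = x0 \<otimes>\<^bsub>P\<^esub> h" using rep[OF X0 x0 xy(1)] by auto
        have "y \<otimes>\<^bsub>P\<^esub> inv\<^bsub>P\<^esub> h \<in> Y"
          using translate[OF Y xy(2)] subgroup.m_inv_closed[OF H h(1)] by simp
        moreover have "snd (y \<otimes>\<^bsub>P\<^esub> inv\<^bsub>P\<^esub> h) = snd x0 + snd (inv\<^bsub>P\<^esub> x \<otimes>\<^bsub>P\<^esub> y)"
          using XP[OF X0 xy(1)] HP[OF h(1)] h(2) by (simp add: snd_mult_P snd_inv_P)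
        ultimately show ?thesis using xy(3)
          by (intro bexI[of _ "y \<otimes>\<^bsub>P\<^esub> inv\<^bsub>P\<^esub> h"]) (auto simp: I_def)
      qed
      then obtain y where y: "\<And>Y. Y \<in> C \<Longrightarrow> y Y \<in> Y" "\<And>Y. Y \<in> C \<Longrightarrow> snd (y Y) \<in> I"
        by metis
      have yP: "y Y \<in> carrier P" if "Y \<in> C" for Y using XP that y by blast
      define level where "level k = {Y \<in> C. snd (y Y) = k}" for k
      have "card (level k) \<le> M" for k
      proof (cases "level k = {}")
        case False
        then obtain Z where Z: "Z \<in> C" "snd (y Z) = k" by (auto simp: level_def)
        \<comment> \<open>the vector part of the representatives, after translating one of them to the identity\<close>
        define b where "b Y = fst (inv\<^bsub>P\<^esub> (y Z) \<otimes>\<^bsub>P\<^esub> y Y)" for Y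
        have b: "inv\<^bsub>P\<^esub> (y Z) \<otimes>\<^bsub>P\<^esub> y Y = (b Y, 0)" if "Y \<in> level k" for Y
          using that Z yP[OF Z(1)] by (auto simp: b_def level_def prod_eq_iff snd_mult_P snd_inv_P)
        have b_vec: "b Y \<in> carrier_vec n" if "Y \<in> level k" for Y
        proof -
          have "(b Y, 0) \<in> carrier P"
            unfolding b[OF that, symmetric] using yP Z that by (simp add: level_def)
          then show ?thesis by (simp add: carrier_P)
        qed
        have quotient: "inv\<^bsub>P\<^esub> (y Y) \<otimes>\<^bsub>P\<^esub> y X = (b X - b Y, 0)"
          if XY: "X \<in> level k" "Y \<in> level k" for X Y
        proof -
          have P: "y X \<in> carrier P" "y Y \<in> carrier P" "y Z \<in> carrier P"
            using XY Z yP by (auto simp: level_def)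
          have "inv\<^bsub>P\<^esub> (y Y) \<otimes>\<^bsub>P\<^esub> y X =
              inv\<^bsub>P\<^esub> (inv\<^bsub>P\<^esub> (y Z) \<otimes>\<^bsub>P\<^esub> y Y) \<otimes>\<^bsub>P\<^esub> (inv\<^bsub>P\<^esub> (y Z) \<otimes>\<^bsub>P\<^esub> y X)"
            using P by (simp add: P.inv_mult_group P.m_assoc) (simp add: P.m_assoc[symmetric])
          also have "\<dots> = (- b Y + b X, 0)"
            using XY b_vec by (simp add: b inv_P_vec mult_P act_0)
          also have "- b Y + b X = b X - b Y"
            using b_vec[OF XY(1)] b_vec[OF XY(2)] by auto
          finally show ?thesis .
        qed
        have not_K: "L (b X) - L (b Y) \<notin> L ` K"
          if XY: "X \<in> level k" "Y \<in> level k" "X \<noteq> Y" for X Y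
        proof
          assume "L (b X) - L (b Y) \<in> L ` K"
          then obtain v where v: "v \<in> K" "L (b X - b Y) = L v"
            using L_diff b_vec XY by auto
          then have "b X - b Y = v"
            using L_inj b_vec XY K_vec by (auto dest: inj_onD)
          then have q: "inv\<^bsub>P\<^esub> (y Y) \<otimes>\<^bsub>P\<^esub> y X \<in> H"
            using v quotient[OF XY(1,2)] by (simp add: K_def)
          have "y Y \<otimes>\<^bsub>P\<^esub> (inv\<^bsub>P\<^esub> (y Y) \<otimes>\<^bsub>P\<^esub> y X) \<in> Y"
            using translate[OF _ _ q] y(1) XY by (auto simp: level_def)
          then have "y X \<in> Y"
            using yP XY by (simp add: level_def P.m_assoc[symmetric])
          then show False
            using cosetE[of X "y X"] cosetE[of Y "y X"] C(2) XY y(1) by (auto simp: level_def)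
        qed
        have "card ((L \<circ> b) ` level k) \<le> M"
        proof (rule M[rule_format])
          show "finite ((L \<circ> b) ` level k)" using C by (simp add: level_def)
          fix x x' assume "x \<in> (L \<circ> b) ` level k" "x' \<in> (L \<circ> b) ` level k" "x \<noteq> x'"
          then obtain X Y where XY: "X \<in> level k" "Y \<in> level k" "X \<noteq> Y"
            and x: "x = L (b X)" "x' = L (b Y)" by auto
          obtain p q where pq: "p \<in> Y" "q \<in> X" "inv\<^bsub>P\<^esub> p \<otimes>\<^bsub>P\<^esub> q \<in> B"
            using close[of Y X] XY by (auto simp: level_def)
          obtain g where g: "g \<in> H" "p = y Y \<otimes>\<^bsub>P\<^esub> g"
            using rep[of Y "y Y" p] pq XY y(1) by (auto simp: level_def)
          obtain h where h: "h \<in> H" "q = y X \<otimes>\<^bsub>P\<^esub> h"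
            using rep[of X "y X" q] pq XY y(1) by (auto simp: level_def)
          have P: "y X \<in> carrier P" "y Y \<in> carrier P" "g \<in> carrier P" "h \<in> carrier P"
            using XY yP HP g h by (auto simp: level_def)
          have "g \<otimes>\<^bsub>P\<^esub> (inv\<^bsub>P\<^esub> p \<otimes>\<^bsub>P\<^esub> q) \<otimes>\<^bsub>P\<^esub> inv\<^bsub>P\<^esub> h =
              inv\<^bsub>P\<^esub> (y Y) \<otimes>\<^bsub>P\<^esub> y X"
            unfolding g(2) h(2) using P
            by (simp add: P.inv_mult_group P.m_assoc[symmetric]) (simp add: P.m_assoc)
          also have "\<dots> = (b X - b Y, 0)" by (rule quotient[OF XY(1,2)])
          finally obtain s f u w where f: "f \<in> F" and uw: "u \<in> K" "w \<in> K"
            and eq: "(b X - b Y) + w = u + act (m * s) f"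
            using HBH[OF g(1) pq(3) h(1)] by (auto simp: K_def)
          have "L (b X) - L (b Y) + L w = L u + T s (L f)"
            using arg_cong[OF eq, of L] uw f F(2) b_vec[OF XY(1)] b_vec[OF XY(2)] K_vec act_closed
            by (auto simp: L_add L_diff T_L subset_iff)
          then have "x - x' - T s (L f) = L u - L w"
            unfolding x by (simp only: algebra_simps)
          also have "\<dots> = L (u - w)" using uw K_vec by (simp add: L_diff)
          finally have "x - x' - T s (L f) \<in> L ` K" using K_diff[OF uw] by simp
          then show "x - x' \<notin> L ` K \<and> (\<exists>s. \<exists>f\<in>L ` F. x - x' - T s f \<in> L ` K)"
            using not_K[OF XY] f x by blast
        qed
        moreover have "inj_on (L \<circ> b) (level k)"
          by (rule inj_onI) (use not_K K_zero L_zero in force)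
        ultimately show ?thesis by (simp only: card_image)
      qed simp
      have "C = (\<Union>k\<in>I. level k)" using y by (auto simp: level_def)
      then have "card C \<le> (\<Sum>k\<in>I. card (level k))" using card_UN_le[OF I(1), of level] by simp
      also have "\<dots> \<le> card I * M" using sum_bounded_above[of I "\<lambda>k. card (level k)" M] \<open>\<And>k. card (level k) \<le> M\<close> by simp
      also have "\<dots> \<le> Suc (card B) * M" using I(2) by (rule mult_le_mono1)
      finally show ?thesis .
    qed simp
  qed
qed

end

theorem theorem6p4:
  fixes n :: nat and \<phi> :: "int vec \<Rightarrow> int vec" and H :: "(int vec \<times> int) set"
  assumes "n \<ge> 1"
    and "\<phi> \<in> auto (Zn n)"
    and "diagonalizable_over_reals n \<phi>"
    and "subgroup H (Zn_semidirect_Z n \<phi>)"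
  shows "bounded_packing (Zn_semidirect_Z n \<phi>) H"
proof -
  interpret Zn_automorphism n \<phi> by unfold_locales (rule assms(2))
  show ?thesis
    unfolding bounded_packing_def
    using finite_generating_set_P P.bounded_packing_wrtI[OF _ assms(4) close_cosets_bounded[OF assms(3,4)]]
    by blast
qed

end
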